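(* Let $p$ be an odd prime and $\alpha,\beta,\gamma,\delta,\epsilon\in\mathbb Z_p$. Suppose that (i) $\langle-\alpha\rangle_p\leq\min\{\langle-\beta\rangle_p, \langle-\gamma\rangle_p,\langle-\delta\rangle_p, \langle-\epsilon\rangle_p\}$; (ii) $p+\langle-\alpha\rangle_p>\max\{\langle-\beta\rangle_p+\langle-\gamma\rangle_p,\ \langle-\beta\rangle_p+\langle-\delta\rangle_p,\ \langle-\beta\rangle_p+\langle-\epsilon\rangle_p,\ \langle-\gamma\rangle_p+\langle-\delta\rangle_p\}$; (iii) $2p-1+\langle-\alpha\rangle_p\leq \langle-\beta\rangle_p+\langle-\gamma\rangle_p+\langle-\delta\rangle_p+\langle-\epsilon\rangle_p$; (iv) $(\alpha-\beta+1)_{p-1},(\alpha-\gamma+1)_{p-1},(\alpha-\delta+1)_{p-1},(\alpha-\epsilon+1)_{p-1}\not\equiv0\pmod{p^2}$. Then $$ {}_7F_6\bigg[\begin{matrix}\alpha&\alpha&1+\frac12\alpha&\beta&\gamma&\delta&\epsilon\\&1&\frac12\alpha&\alpha-\beta+1&\alpha-\gamma+1&\alpha-\delta+1&\alpha-\epsilon+1\end{matrix}\bigg|\,1\bigg]_{p-1}\equiv0\pmod{p^2}. $$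
   Context: $\mathbb Z_p$ denotes the $p$-adic integers. For $\alpha\in\mathbb Z_p$, $\langle\alpha\rangle_p$ is the unique integer in $\{0,1,\ldots,p-1\}$ congruent to $\alpha$ modulo $p$. Pochhammer symbol: $(x)_0=1$, $(x)_k=x(x+1)\cdots(x+k-1)$. For $n\ge 0$ the truncated hypergeometric series is ${}_{m+1}F_m\Big[\begin{matrix}\alpha_0&\alpha_1&\ldots&\alpha_m\\&\beta_1&\ldots&\beta_m\end{matrix}\Big|\,z\Big]_n=\sum_{k=0}^{n}\frac{(\alpha_0)_k\cdots(\alpha_m)_k}{(\beta_1)_k\cdots(\beta_m)_k}\cdot\frac{z^k}{k!}$. For $x,y\in\mathbb Q_p$, $x\equiv y\pmod{p^2}$ means $x-y\in p^2\mathbb Z_p$. *)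

theory Defs
  imports
    "HOL-Computational_Algebra.Polynomial_Factorial"
    "Berlekamp_Zassenhaus.Finite_Field"
begin

text \<open>
  The prime \<open>p\<close> is the cardinality of an index type of class \<^class>\<open>prime_card\<close>.
  The ring of \<open>p\<close>-adic integers is the inverse limit of the rings \<open>\<int>/p\<^sup>n\<close>, each residue class
  being represented by its least nonnegative element (the compatibility condition forces
  \<open>f n \<in> {0..<p\<^sup>n}\<close>).
\<close>

typedef (overloaded) 'p padic_int =
  "{f :: nat \<Rightarrow> int. \<forall>n. f (Suc n) mod int CARD('p :: prime_card) ^ n = f n}"
  by (rule exI[of _ "\<lambda>_. 0"]) simp

setup_lifting type_definition_padic_int

lemma card_gt_1: "int CARD('p :: prime_card) > 1"
  using prime_gt_1_nat[OF prime_card[where 'a = 'p]] by simp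

lemma mod_power_Suc_mod:
  "(a :: int) mod q ^ Suc n mod q ^ n = a mod q ^ n"
  by (simp add: mod_mod_cancel le_imp_power_dvd)

lemma compat_mod:
  assumes "\<And>n. f (Suc n) mod (q :: int) ^ n = f n"
  shows "f n mod q ^ n = f n"
  by (metis assms mod_mod_trivial)

lemma compat_mod_le:
  assumes "\<And>n. f (Suc n) mod (q :: int) ^ n = f n" and "n \<le> m"
  shows "f m mod q ^ n = f n"
  using assms(2)
proof (induction m rule: dec_induct)
  case base
  show ?case by (rule compat_mod[OF assms(1)])
next
  case (step m)
  have "f m mod q ^ n = f (Suc m) mod q ^ m mod q ^ n"
    by (simp add: assms(1))
  also have "\<dots> = f (Suc m) mod q ^ n"
    using step(1) by (simp add: mod_mod_cancel le_imp_power_dvd)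
  finally show ?case using step by simp
qed

lemma lift_compat:
  assumes "\<And>n. f (Suc n) mod q ^ n = f n mod (q :: int) ^ n"
  shows "(f (Suc n) mod q ^ Suc n) mod q ^ n = f n mod q ^ n"
  using assms by (simp only: mod_power_Suc_mod)

instantiation padic_int :: (prime_card) comm_ring_1
begin

lift_definition zero_padic_int :: "'a padic_int" is "\<lambda>_. 0"
  by simp

lift_definition one_padic_int :: "'a padic_int" is "\<lambda>n. 1 mod int CARD('a) ^ n"
  by (simp only: mod_power_Suc_mod)

lift_definition plus_padic_int :: "'a padic_int \<Rightarrow> 'a padic_int \<Rightarrow> 'a padic_int"
  is "\<lambda>f g n. (f n + g n) mod int CARD('a) ^ n"
  by (intro allI lift_compat) (metis mod_add_eq mod_mod_trivial)

lift_definition uminus_padic_int :: "'a padic_int \<Rightarrow> 'a padic_int"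
  is "\<lambda>f n. (- f n) mod int CARD('a) ^ n"
  by (intro allI lift_compat) (metis mod_minus_eq)

lift_definition minus_padic_int :: "'a padic_int \<Rightarrow> 'a padic_int \<Rightarrow> 'a padic_int"
  is "\<lambda>f g n. (f n - g n) mod int CARD('a) ^ n"
  by (intro allI lift_compat) (metis mod_diff_eq mod_mod_trivial)

lift_definition times_padic_int :: "'a padic_int \<Rightarrow> 'a padic_int \<Rightarrow> 'a padic_int"
  is "\<lambda>f g n. (f n * g n) mod int CARD('a) ^ n"
  by (intro allI lift_compat) (metis mod_mult_eq mod_mod_trivial)

instance
proof
  fix a b c :: "'a padic_int"
  show "a * b * c = a * (b * c)"
    by transfer (simp add: fun_eq_iff mod_mult_left_eq mod_mult_right_eq mult.assoc)
  show "a * b = b * a"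
    by transfer (simp add: mult.commute)
  show "1 * a = a"
    by transfer (auto simp add: fun_eq_iff mod_mult_left_eq compat_mod)
  show "a + b + c = a + (b + c)"
    by transfer (simp add: fun_eq_iff mod_add_left_eq mod_add_right_eq add.assoc)
  show "a + b = b + a"
    by transfer (simp add: add.commute)
  show "0 + a = a"
    by transfer (auto simp add: fun_eq_iff compat_mod)
  show "- a + a = 0"
    by transfer (simp add: fun_eq_iff mod_add_left_eq)
  show "a - b = a + - b"
    by transfer (simp add: fun_eq_iff mod_add_right_eq)
  show "(a + b) * c = a * c + b * c"
    by transfer (simp add: fun_eq_iff mod_mult_left_eq mod_add_eq distrib_right)
  show "(0 :: 'a padic_int) \<noteq> 1"
  proof transfer
    have "(1 :: int) mod int CARD('a) ^ 1 = 1"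
      using card_gt_1[where 'p = 'a] by simp
    thus "(\<lambda>_. 0) \<noteq> (\<lambda>n. 1 mod int CARD('a) ^ n)"
      by (metis zero_neq_one)
  qed
qed

end

lemma prime_power_dvd_mult_int:
  assumes q: "prime (q :: int)" and "q ^ (m + n) dvd a * b"
  shows "q ^ m dvd a \<or> q ^ n dvd b"
proof (cases "a = 0 \<or> b = 0")
  case False
  have pe: "prime_elem q" using q by (rule prime_imp_prime_elem)
  have "m + n \<le> multiplicity q (a * b)"
    using assms(2) False q
    by (subst (asm) power_dvd_iff_le_multiplicity) (auto simp: prime_gt_1_int)
  also have "\<dots> = multiplicity q a + multiplicity q b"
    using False by (intro prime_elem_multiplicity_mult_distrib[OF pe]) auto
  finally have "m \<le> multiplicity q a \<or> n \<le> multiplicity q b" by linarith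
  thus ?thesis by (auto intro: multiplicity_dvd')
qed auto

instance padic_int :: (prime_card) idom
proof
  fix a b :: "'a padic_int"
  assume "a \<noteq> 0" "b \<noteq> 0"
  thus "a * b \<noteq> 0"
  proof transfer
    fix f g :: "nat \<Rightarrow> int"
    let ?q = "int CARD('a)"
    assume f: "\<forall>n. f (Suc n) mod ?q ^ n = f n" and g: "\<forall>n. g (Suc n) mod ?q ^ n = g n"
      and "f \<noteq> (\<lambda>_. 0)" "g \<noteq> (\<lambda>_. 0)"
    then obtain m n where mn: "f m \<noteq> 0" "g n \<noteq> 0" by (auto simp: fun_eq_iff)
    have pr: "prime ?q" using prime_card[where 'a = 'a] by simp
    have "f (m + n) mod ?q ^ m = f m"
      by (rule compat_mod_le) (use f in simp_all)
    moreover have "g (m + n) mod ?q ^ n = g n"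
      by (rule compat_mod_le) (use g in simp_all)
    ultimately have "\<not> ?q ^ m dvd f (m + n)" "\<not> ?q ^ n dvd g (m + n)"
      using mn by (simp_all only: dvd_eq_mod_eq_0 not_False_eq_True)
    hence "\<not> ?q ^ (m + n) dvd f (m + n) * g (m + n)"
      using prime_power_dvd_mult_int[OF pr] by blast
    hence "f (m + n) * g (m + n) mod ?q ^ (m + n) \<noteq> 0"
      by (simp only: dvd_eq_mod_eq_0 not_False_eq_True)
    thus "(\<lambda>n. f n * g n mod ?q ^ n) \<noteq> (\<lambda>_. 0)" by (rule contrapos_nn) (rule fun_cong)
  qed
qed

type_synonym 'p padic = "'p padic_int fract"

definition Zp :: "'p :: prime_card padic set" where
  "Zp = range to_fract"

text \<open>Congruence modulo \<open>p\<^sup>n\<close> in the sense \<open>x - y \<in> p\<^sup>n \<int>\<^sub>p\<close>, for arbitrary \<open>x\<close>, \<open>y\<close> in \<open>\<rat>\<^sub>p\<close>.\<close>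

definition padic_cong :: "nat \<Rightarrow> 'p :: prime_card padic \<Rightarrow> 'p padic \<Rightarrow> bool" where
  "padic_cong n x y \<longleftrightarrow> x - y \<in> (\<lambda>z. of_nat CARD('p) ^ n * z) ` Zp"

text \<open>The least nonnegative residue \<open>\<langle>x\<rangle>\<^sub>p\<close>; meaningful for \<open>x \<in> Zp\<close> only.\<close>

definition residue :: "'p :: prime_card padic \<Rightarrow> nat" where
  "residue x = (THE r. r < CARD('p) \<and> padic_cong 1 x (of_nat r))"

text \<open>
  Meaningful only if no denominator \<open>pochhammer b k\<close> with \<open>k \<le> n\<close> vanishes,
  because division by zero yields zero in HOL. The lists \<open>as\<close> and \<open>bs\<close> are the upper and the
  lower parameters; the factor \<open>k!\<close> is not among the latter.
\<close>

definition hypergeom_trunc :: "'a :: field list \<Rightarrow> 'a list \<Rightarrow> 'a \<Rightarrow> nat \<Rightarrow> 'a" where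
  "hypergeom_trunc as bs z n =
     (\<Sum>k=0..n. (\<Prod>a\<leftarrow>as. pochhammer a k) / (\<Prod>b\<leftarrow>bs. pochhammer b k) * (z ^ k / of_nat (fact k)))"

lemma Rep_padic_int_compat:
  "Rep_padic_int (z :: 'p :: prime_card padic_int) (Suc n) mod int CARD('p) ^ n = Rep_padic_int z n"
  using Rep_padic_int[of z] by blast

lemma Rep_padic_int_of_nat:
  "Rep_padic_int (of_nat m :: 'p :: prime_card padic_int) n = int m mod int CARD('p) ^ n"
proof (induction m)
  case 0
  show ?case by (simp add: zero_padic_int.rep_eq)
next
  case (Suc m)
  thus ?case
    by (simp add: plus_padic_int.rep_eq one_padic_int.rep_eq mod_add_eq add.commute)
qed

lemma card_dvd_padic_int_iff:
  "of_nat CARD('p) dvd (z :: 'p :: prime_card padic_int) \<longleftrightarrow> Rep_padic_int z 1 = 0"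
proof
  assume "of_nat CARD('p) dvd z"
  thus "Rep_padic_int z 1 = 0"
    by (auto simp: dvd_def times_padic_int.rep_eq Rep_padic_int_of_nat)
next
  let ?q = "int CARD('p)"
  assume z1: "Rep_padic_int z 1 = 0"
  define w where "w n = Rep_padic_int z (Suc n) div ?q" for n
  have q: "?q > 1" by (rule card_gt_1)
  have dvd: "?q dvd Rep_padic_int z (Suc n)" for n
    using compat_mod_le[of "Rep_padic_int z" ?q 1 "Suc n"] z1
    by (auto simp: Rep_padic_int_compat dvd_eq_mod_eq_0)
  have w: "?q * w n = Rep_padic_int z (Suc n)" for n
    using dvd[of n] by (simp add: w_def)
  have "w (Suc n) mod ?q ^ n = w n" for n
  proof -
    have "?q * (w (Suc n) mod ?q ^ n) = (?q * w (Suc n)) mod ?q ^ Suc n"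
      by (simp only: mult_mod_right power_Suc)
    also have "\<dots> = ?q * w n" by (simp only: w Rep_padic_int_compat)
    finally have "?q * (w (Suc n) mod ?q ^ n) = ?q * w n" .
    moreover have "?q \<noteq> 0" using q by linarith
    ultimately show ?thesis by (simp only: mult_cancel_left simp_thms)
  qed
  hence Rw: "Rep_padic_int (Abs_padic_int w :: 'p padic_int) = w"
    by (intro Abs_padic_int_inverse) blast
  have "z = of_nat CARD('p) * Abs_padic_int w"
  proof (rule Rep_padic_int_inject[THEN iffD1], rule ext)
    fix n
    have "Rep_padic_int (of_nat CARD('p) * Abs_padic_int w :: 'p padic_int) n = ?q * w n mod ?q ^ n"
      by (simp add: times_padic_int.rep_eq Rep_padic_int_of_nat Rw mod_mult_left_eq)
    thus "Rep_padic_int z n = Rep_padic_int (of_nat CARD('p) * Abs_padic_int w :: 'p padic_int) n"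
      by (simp only: w Rep_padic_int_compat)
  qed
  thus "of_nat CARD('p) dvd z" by simp
qed

lemma of_nat_to_fract: "of_nat m = to_fract (of_nat m)"
  by (simp add: to_fract_def of_nat_fract)

lemma padic_cong_1_to_fract_iff:
  "padic_cong 1 (to_fract x) (to_fract y :: 'p :: prime_card padic) \<longleftrightarrow>
     Rep_padic_int x 1 = Rep_padic_int y 1"
proof -
  have "padic_cong 1 (to_fract x) (to_fract y) \<longleftrightarrow> of_nat CARD('p) dvd x - y"
    by (auto simp: padic_cong_def Zp_def image_iff of_nat_to_fract dvd_def
          simp flip: to_fract_mult to_fract_diff)
  also have "\<dots> \<longleftrightarrow> (Rep_padic_int x 1 - Rep_padic_int y 1) mod int CARD('p) = 0"
    by (simp add: card_dvd_padic_int_iff minus_padic_int.rep_eq)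
  also have "\<dots> \<longleftrightarrow> Rep_padic_int x 1 mod int CARD('p) = Rep_padic_int y 1 mod int CARD('p)"
    by (simp add: mod_eq_dvd_iff dvd_eq_mod_eq_0)
  also have "\<dots> \<longleftrightarrow> Rep_padic_int x 1 = Rep_padic_int y 1"
    using compat_mod[of "Rep_padic_int x" "int CARD('p)" 1, OF Rep_padic_int_compat]
      compat_mod[of "Rep_padic_int y" "int CARD('p)" 1, OF Rep_padic_int_compat] by simp
  finally show ?thesis .
qed

lemma ex1_residue:
  assumes "(x :: 'p :: prime_card padic) \<in> Zp"
  shows "\<exists>!r. r < CARD('p) \<and> padic_cong 1 x (of_nat r)"
proof -
  obtain z where z: "x = to_fract z" using assms by (auto simp: Zp_def)
  have b: "0 \<le> Rep_padic_int z 1" "Rep_padic_int z 1 < int CARD('p)"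
    using compat_mod[of "Rep_padic_int z" "int CARD('p)" 1, OF Rep_padic_int_compat]
      card_gt_1[where 'p = 'p]
    by (metis pos_mod_sign pos_mod_bound power_one_right less_trans zero_less_one)+
  have "padic_cong 1 x (of_nat r) \<longleftrightarrow> Rep_padic_int z 1 = int r" if "r < CARD('p)" for r
    using that unfolding z of_nat_to_fract padic_cong_1_to_fract_iff
    by (simp add: Rep_padic_int_of_nat)
  moreover have "Rep_padic_int z 1 = int (nat (Rep_padic_int z 1))"
    "nat (Rep_padic_int z 1) < CARD('p)" using b by linarith+
  ultimately show ?thesis by (metis of_nat_eq_iff)
qed

end

theory Submission
  imports Defs "HOL-Number_Theory.Cong"
begin

text \<open>
  Put \<open>a = \<langle>-\<alpha>\<rangle>\<close>, \<open>b = \<langle>-\<beta>\<rangle>\<close>, ..., \<open>e = \<langle>-\<epsilon>\<rangle>\<close> and \<open>\<alpha> = -a + \<xi>\<close> with \<open>p\<close> dividing \<open>\<xi>\<close>. Hypotheses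
  (ii) and (iii) force \<open>a > 0\<close>, so \<open>\<alpha>\<close> is a unit. By (ii) and (iv), each factor \<open>p\<close> in the denominator
  of a term with \<open>k > a\<close> is compensated by one in the numerator, and \<open>((\<alpha>)\<^sub>k)\<^sup>2\<close> contributes \<open>p\<^sup>2\<close>; these
  terms vanish.

  The sum over \<open>k \<le> a\<close> is \<open>H \<xi> \<xi>\<close>, where \<open>H x y\<close> is the well-poised sum in which the two copies of \<open>\<alpha>\<close>
  are replaced by \<open>-a + x\<close> and \<open>-a + y\<close>. Modulo \<open>p\<^sup>2\<close> it equals \<open>H \<xi> 0 + H 0 \<xi> - H 0 0\<close>. The sums \<open>H 0 y\<close>
  vanish because their terms are antisymmetric under \<open>k \<mapsto> a - k\<close>. Whipple's 7F6-to-4F3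
  transformation writes \<open>H \<xi> 0\<close> as \<open>(\<alpha>)\<^sub>a\<^sub>+\<^sub>1\<close>, a multiple of \<open>p\<close>, times a sum all of whose terms are
  multiples of \<open>p\<close> by (ii) and (iii), provided that the parameters are paired as \<open>{\<beta>, \<epsilon>}\<close> and \<open>{\<gamma>, \<delta>}\<close>.
\<close>

subsection \<open>Terminating hypergeometric sums\<close>

text \<open>
  Factorials are written \<open>pochhammer 1 k\<close>, because \<open>fact\<close> needs characteristic 0 in the type class.
  The two telescoping lemmas are WZ pairs in the parameter \<open>n\<close>, respectively \<open>k\<close>.
\<close>

lemma dougall_5F4_telescope:
  fixes \<alpha> \<gamma> \<delta> :: "'a::field"
  assumes "pochhammer 1 N \<noteq> (0::'a)" "pochhammer (1 + \<alpha> + of_nat n) (Suc N) \<noteq> 0"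
    "pochhammer (1 + \<alpha> - \<gamma>) N \<noteq> 0" "pochhammer (1 + \<alpha> - \<delta>) N \<noteq> 0"
  defines "F \<equiv> \<lambda>n k. pochhammer \<alpha> k * (\<alpha> + 2 * of_nat k) * pochhammer \<gamma> k * pochhammer \<delta> k * pochhammer (- of_nat n) k
      / (pochhammer 1 k * pochhammer (1 + \<alpha> - \<gamma>) k * pochhammer (1 + \<alpha> - \<delta>) k * pochhammer (1 + \<alpha> + of_nat n) k)"
  shows "(\<Sum>k\<le>N. (1 + \<alpha> - \<gamma> + of_nat n) * (1 + \<alpha> - \<delta> + of_nat n) * F (Suc n) k
            - (1 + \<alpha> + of_nat n) * (1 + \<alpha> - \<gamma> - \<delta> + of_nat n) * F n k) =
     pochhammer \<alpha> (Suc N) * pochhammer \<gamma> (Suc N) * pochhammer \<delta> (Suc N) * pochhammer (- of_nat n) N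
      / (pochhammer 1 N * pochhammer (1 + \<alpha> - \<gamma>) N * pochhammer (1 + \<alpha> - \<delta>) N * pochhammer (2 + \<alpha> + of_nat n) N)"
  using assms(1-4)
proof (induction N)
  case 0
  show ?case by (simp add: F_def algebra_simps)
next
  case (Suc N)
  \<comment> \<open>Over the denominators of index \<open>N + 1\<close>, the old partial sum, the
    two new summands with their coefficients and the claimed right-hand side are all polynomial
    multiples of \<open>W\<close>. The induction step thus becomes a polynomial identity.\<close>
  define W where "W = pochhammer \<alpha> (Suc N) * pochhammer \<gamma> (Suc N) * pochhammer \<delta> (Suc N) * pochhammer (- of_nat n) N
      / (pochhammer 1 (Suc N) * pochhammer (1 + \<alpha> - \<gamma>) (Suc N) * pochhammer (1 + \<alpha> - \<delta>) (Suc N) * pochhammer (2 + \<alpha> + of_nat n) (Suc N))"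
  \<comment> \<open>\<open>F n\<close> has the lower parameter \<open>1 + \<alpha> + n\<close>,
    \<open>F (Suc n)\<close> has \<open>2 + \<alpha> + n\<close>; splitting off the first factor
    brings both to the latter.\<close>
  have r: "pochhammer (1 + \<alpha> + of_nat n) (Suc k) = (1 + \<alpha> + of_nat n) * pochhammer (2 + \<alpha> + of_nat n) k" for k
    by (simp add: pochhammer_rec add_ac)
  have nz: "1 + of_nat N \<noteq> (0::'a)" "1 + \<alpha> - \<gamma> + of_nat N \<noteq> 0" "1 + \<alpha> - \<delta> + of_nat N \<noteq> 0"
      "2 + \<alpha> + of_nat n + of_nat N \<noteq> 0" "1 + \<alpha> + of_nat n \<noteq> 0"
      "pochhammer (2 + \<alpha> + of_nat n) N \<noteq> 0"
    using Suc.prems unfolding r by (simp_all add: pochhammer_Suc)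
  have ih: "(\<Sum>k\<le>N. (1 + \<alpha> - \<gamma> + of_nat n) * (1 + \<alpha> - \<delta> + of_nat n) * F (Suc n) k
            - (1 + \<alpha> + of_nat n) * (1 + \<alpha> - \<gamma> - \<delta> + of_nat n) * F n k) = 
      W * ((1 + of_nat N) * (1 + \<alpha> - \<gamma> + of_nat N) * (1 + \<alpha> - \<delta> + of_nat N) * (2 + \<alpha> + of_nat n + of_nat N))"
  proof -
    have aux: "A / (b * c * d * e) = A / ((b * b') * (c * c') * (d * d') * (e * e')) * (b' * c' * d' * e')"
      if "b' \<noteq> 0" "c' \<noteq> 0" "d' \<noteq> 0" "e' \<noteq> 0" for A b c d e b' c' d' e' :: 'a
      using that by (simp add: divide_simps)
    have prems: "pochhammer 1 N \<noteq> (0::'a)" "pochhammer (1 + \<alpha> + of_nat n) (Suc N) \<noteq> 0"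
        "pochhammer (1 + \<alpha> - \<gamma>) N \<noteq> 0" "pochhammer (1 + \<alpha> - \<delta>) N \<noteq> 0"
      using Suc.prems by (simp_all add: pochhammer_Suc[of _ N] pochhammer_Suc[of _ "Suc N"])
    show ?thesis
      unfolding Suc.IH[OF prems] W_def pochhammer_Suc[of 1 N] pochhammer_Suc[of "1 + \<alpha> - \<gamma>" N]
        pochhammer_Suc[of "1 + \<alpha> - \<delta>" N] pochhammer_Suc[of "2 + \<alpha> + of_nat n" N]
      by (rule aux) (use nz in simp_all)
  qed
  have g: "pochhammer \<alpha> (Suc (Suc N)) * pochhammer \<gamma> (Suc (Suc N)) * pochhammer \<delta> (Suc (Suc N)) * pochhammer (- of_nat n) (Suc N)
      / (pochhammer 1 (Suc N) * pochhammer (1 + \<alpha> - \<gamma>) (Suc N) * pochhammer (1 + \<alpha> - \<delta>) (Suc N) * pochhammer (2 + \<alpha> + of_nat n) (Suc N))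
     = W * ((\<alpha> + 1 + of_nat N) * (\<gamma> + 1 + of_nat N) * (\<delta> + 1 + of_nat N) * (of_nat N - of_nat n))"
    unfolding W_def pochhammer_Suc[of \<alpha> "Suc N"] pochhammer_Suc[of \<gamma> "Suc N"] pochhammer_Suc[of \<delta> "Suc N"]
      pochhammer_Suc[of "- of_nat n" N]
    by (simp add: ac_simps)
  have f1: "F (Suc n) (Suc N) = W * ((\<alpha> + 2 + 2 * of_nat N) * (- 1 - of_nat n))"
    by (simp add: F_def W_def pochhammer_rec[of "- 1 - of_nat n" N] ac_simps)
  have f2: "(1 + \<alpha> + of_nat n) * F n (Suc N) = W * ((\<alpha> + 2 + 2 * of_nat N) * (of_nat N - of_nat n) * (2 + \<alpha> + of_nat n + of_nat N))"
  proof -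
    have aux: "q * (a * t * g * d * (m * m') / (b * c * e * (q * h))) = a * g * d * m / (b * c * e * (h * h')) * (t * m' * h')"
      if "q \<noteq> 0" "h' \<noteq> 0" for q a t g d m m' b c e h h' :: 'a
      using that by (simp add: divide_simps)
    have t: "\<alpha> + 2 + 2 * of_nat N = \<alpha> + 2 * of_nat (Suc N)" "of_nat N - of_nat n = - of_nat n + (of_nat N :: 'a)"
      by simp_all
    show ?thesis
      unfolding F_def r W_def t pochhammer_Suc[of "2 + \<alpha> + of_nat n" N] pochhammer_Suc[of "- of_nat n" N]
      by (rule aux) (use nz in simp_all)
  qed
  have eq: "(1 + \<alpha> + of_nat n) * (1 + \<alpha> - \<gamma> - \<delta> + of_nat n) * F n (Suc N) = (1 + \<alpha> - \<gamma> - \<delta> + of_nat n) *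
      (W * ((\<alpha> + 2 + 2 * of_nat N) * (of_nat N - of_nat n) * (2 + \<alpha> + of_nat n + of_nat N)))"
    unfolding f2[symmetric] by (simp only: mult_ac)
  show ?case
    unfolding sum.atMost_Suc ih g f1 eq
    by (simp add: algebra_simps)
qed

lemma pochhammer_nonzero_mono:
  fixes x :: "'a::field"
  assumes "pochhammer x n \<noteq> 0" "m \<le> n"
  shows "pochhammer x m \<noteq> 0"
  using assms pochhammer_product[OF assms(2), of x] by auto

lemma pochhammer_nonzero_shift:
  fixes x :: "'a::field"
  assumes "pochhammer x n \<noteq> 0" "m + k \<le> n"
  shows "pochhammer (x + of_nat m) k \<noteq> 0"
  using pochhammer_nonzero_mono[OF assms] pochhammer_product'[of x m k] by auto

text \<open>At \<open>N = n + 1\<close> the telescoped value contains \<open>(-n)_(n+1) = 0\<close>,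
  which leaves a first-order recurrence in \<open>n\<close> that the closed form satisfies. The
  very-well-poised factor is kept as \<open>\<alpha> + 2k\<close>, without division by
  \<open>\<alpha>\<close>, hence \<open>(\<alpha>)_(n+1)\<close> in place of the usual
  \<open>(1 + \<alpha>)_n\<close>.\<close>

lemma dougall_5F4:
  fixes \<alpha> \<gamma> \<delta> :: "'a::field"
  assumes "pochhammer 1 n \<noteq> (0::'a)" "pochhammer (1 + \<alpha>) (2 * n) \<noteq> 0"
    "pochhammer (1 + \<alpha> - \<gamma>) n \<noteq> 0" "pochhammer (1 + \<alpha> - \<delta>) n \<noteq> 0"
  shows "(\<Sum>k\<le>n. pochhammer \<alpha> k * (\<alpha> + 2 * of_nat k) * pochhammer \<gamma> k * pochhammer \<delta> k * pochhammer (- of_nat n) k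
      / (pochhammer 1 k * pochhammer (1 + \<alpha> - \<gamma>) k * pochhammer (1 + \<alpha> - \<delta>) k * pochhammer (1 + \<alpha> + of_nat n) k))
    = pochhammer \<alpha> (Suc n) * pochhammer (1 + \<alpha> - \<gamma> - \<delta>) n / (pochhammer (1 + \<alpha> - \<gamma>) n * pochhammer (1 + \<alpha> - \<delta>) n)"
  using assms
proof (induction n)
  case 0
  show ?case by simp
next
  case (Suc n)
  define F where "F = (\<lambda>n k. pochhammer \<alpha> k * (\<alpha> + 2 * of_nat k) * pochhammer \<gamma> k * pochhammer \<delta> k * pochhammer (- of_nat n) k
      / (pochhammer 1 k * pochhammer (1 + \<alpha> - \<gamma>) k * pochhammer (1 + \<alpha> - \<delta>) k * pochhammer (1 + \<alpha> + of_nat n) k))"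
  let ?c = "(1 + \<alpha> - \<gamma> + of_nat n) * (1 + \<alpha> - \<delta> + of_nat n)"
  let ?d = "(1 + \<alpha> + of_nat n) * (1 + \<alpha> - \<gamma> - \<delta> + of_nat n)"
  have nz: "?c \<noteq> 0"
    using Suc.prems by (simp add: pochhammer_Suc)
  have prems: "pochhammer 1 n \<noteq> (0::'a)" "pochhammer (1 + \<alpha>) (2 * n) \<noteq> 0"
    "pochhammer (1 + \<alpha> - \<gamma>) n \<noteq> 0" "pochhammer (1 + \<alpha> - \<delta>) n \<noteq> 0"
    using pochhammer_nonzero_mono Suc.prems by (metis le_SucI order_refl mult_le_mono2)+
  \<comment> \<open>Since \<open>n + (n + 2) = 2 * Suc n\<close>, the hypothesis on
    \<open>1 + \<alpha>\<close> has exactly the length that the telescoping identity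
    requires.\<close>
  have nz2: "pochhammer (1 + \<alpha> + of_nat n) (Suc (Suc n)) \<noteq> 0"
    by (rule pochhammer_nonzero_shift[OF Suc.prems(2)]) simp
  have "?c * (\<Sum>k\<le>Suc n. F (Suc n) k) - ?d * (\<Sum>k\<le>Suc n. F n k) = (\<Sum>k\<le>Suc n. ?c * F (Suc n) k - ?d * F n k)"
    by (simp only: sum_subtractf sum_distrib_left)
  also have "\<dots> = 0"
    unfolding F_def dougall_5F4_telescope[OF Suc.prems(1) nz2 Suc.prems(3,4)]
    by (simp add: pochhammer_of_nat_eq_0_lemma)
  finally have "?c * (\<Sum>k\<le>Suc n. F (Suc n) k) = ?d * (\<Sum>k\<le>Suc n. F n k)"
    by simp
  also have "(\<Sum>k\<le>Suc n. F n k) = (\<Sum>k\<le>n. F n k)"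
    by (simp add: F_def pochhammer_of_nat_eq_0_lemma)
  also have "(\<Sum>k\<le>n. F n k) = pochhammer \<alpha> (Suc n) * pochhammer (1 + \<alpha> - \<gamma> - \<delta>) n / (pochhammer (1 + \<alpha> - \<gamma>) n * pochhammer (1 + \<alpha> - \<delta>) n)"
    unfolding F_def by (rule Suc.IH[OF prems])
  finally have "?c * (\<Sum>k\<le>Suc n. F (Suc n) k) = ?d * \<dots>" .
  hence *: "(\<Sum>k\<le>Suc n. F (Suc n) k) = ?d * (pochhammer \<alpha> (Suc n) * pochhammer (1 + \<alpha> - \<gamma> - \<delta>) n / (pochhammer (1 + \<alpha> - \<gamma>) n * pochhammer (1 + \<alpha> - \<delta>) n)) / ?c"
    by (metis nz nonzero_mult_div_cancel_left)
  have "1 + \<alpha> + of_nat n = \<alpha> + of_nat (Suc n)" by simp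
  thus ?case
    unfolding *[unfolded F_def] pochhammer_Suc[of \<alpha> "Suc n"] pochhammer_Suc[of "1 + \<alpha> - \<gamma>" n]
      pochhammer_Suc[of "1 + \<alpha> - \<delta>" n] pochhammer_Suc[of "1 + \<alpha> - \<gamma> - \<delta>" n]
    by (simp add: ac_simps)
qed

section \<open>Saalschuetz's balanced 3F2 summation\<close>

lemma saalschuetz_telescope:
  fixes b e \<theta> \<beta> \<epsilon> \<alpha> :: "'a::field" and k J :: nat
  assumes "pochhammer 1 J \<noteq> (0::'a)" "pochhammer b J \<noteq> 0" "pochhammer e J \<noteq> 0"
    and \<beta>: "\<beta> = 1 + \<alpha> - b" and \<epsilon>: "\<epsilon> = 1 + \<alpha> - e" and \<theta>: "\<theta> = b + e - 1 - \<alpha>"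
  defines "F \<equiv> \<lambda>k j. pochhammer (- of_nat k) j * pochhammer (\<alpha> + of_nat k) j * pochhammer \<theta> j / (pochhammer 1 j * pochhammer b j * pochhammer e j)"
  shows "(\<Sum>j\<le>J. (\<alpha> + of_nat k) * ((b + of_nat k) * (e + of_nat k) * F (Suc k) j - (\<beta> + of_nat k) * (\<epsilon> + of_nat k) * F k j)) =
     (1 + \<alpha> + 2 * of_nat k) * pochhammer (- of_nat k) J * pochhammer (\<alpha> + of_nat k) (Suc J) * pochhammer \<theta> (Suc J)
      / (pochhammer 1 J * pochhammer b J * pochhammer e J)"
  using assms(1-3)
proof (induction J)
  case 0
  show ?case by (simp add: F_def \<beta> \<epsilon> \<theta> algebra_simps)
next
  case (Suc J)
  \<comment> \<open>Again every quantity is a polynomial multiple of \<open>W\<close>. In the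
    remaining identity \<open>\<alpha>\<close>, \<open>b\<close> and \<open>e\<close> are the
    independent variables; \<open>\<beta>\<close>, \<open>\<epsilon>\<close> and
    \<open>\<theta>\<close> are eliminated at the end.\<close>
  define W where "W = pochhammer (- of_nat k) J * pochhammer (\<alpha> + of_nat k) (Suc J) * pochhammer \<theta> (Suc J)
      / (pochhammer 1 (Suc J) * pochhammer b (Suc J) * pochhammer e (Suc J))"
  have nz: "1 + of_nat J \<noteq> (0::'a)" "b + of_nat J \<noteq> 0" "e + of_nat J \<noteq> 0"
    and prems: "pochhammer 1 J \<noteq> (0::'a)" "pochhammer b J \<noteq> 0" "pochhammer e J \<noteq> 0"
    using Suc.prems by (simp_all add: pochhammer_Suc)
  have ih: "(\<Sum>j\<le>J. (\<alpha> + of_nat k) * ((b + of_nat k) * (e + of_nat k) * F (Suc k) j - (\<beta> + of_nat k) * (\<epsilon> + of_nat k) * F k j)) =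
      W * ((1 + \<alpha> + 2 * of_nat k) * ((1 + of_nat J) * (b + of_nat J) * (e + of_nat J)))"
  proof -
    have aux: "q * A * B * C / (b * c * d) = A * B * C / ((b * b') * (c * c') * (d * d')) * (q * (b' * c' * d'))"
      if "b' \<noteq> 0" "c' \<noteq> 0" "d' \<noteq> 0" for q A B C b c d b' c' d' :: 'a
      using that by (simp add: divide_simps)
    show ?thesis
      unfolding Suc.IH[OF prems] W_def pochhammer_Suc[of 1 J] pochhammer_Suc[of b J] pochhammer_Suc[of e J]
      by (rule aux) (use nz in simp_all)
  qed
  have g: "(1 + \<alpha> + 2 * of_nat k) * pochhammer (- of_nat k) (Suc J) * pochhammer (\<alpha> + of_nat k) (Suc (Suc J)) * pochhammer \<theta> (Suc (Suc J))
      / (pochhammer 1 (Suc J) * pochhammer b (Suc J) * pochhammer e (Suc J)) =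
     W * ((1 + \<alpha> + 2 * of_nat k) * ((- of_nat k + of_nat J) * (\<alpha> + of_nat k + of_nat (Suc J)) * (\<theta> + of_nat (Suc J))))"
    unfolding W_def pochhammer_Suc[of "\<alpha> + of_nat k" "Suc J"] pochhammer_Suc[of \<theta> "Suc J"] pochhammer_Suc[of "- of_nat k" J]
    by (simp add: ac_simps)
  have f2: "F k (Suc J) = W * (- of_nat k + of_nat J)"
    unfolding W_def F_def pochhammer_Suc[of "- of_nat k" J] by (simp add: ac_simps)
  \<comment> \<open>This is why the recurrence carries the multiplier \<open>\<alpha> + k\<close>:
    it completes \<open>(\<alpha> + k + 1)_(J+1)\<close> to \<open>(\<alpha> + k)_(J+2)\<close>, a
    multiple of the factor in \<open>W\<close>.\<close>
  have f1: "(\<alpha> + of_nat k) * F (Suc k) (Suc J) = W * ((- 1 - of_nat k) * (\<alpha> + of_nat k + of_nat (Suc J)))"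
  proof -
    have r: "pochhammer (- of_nat (Suc k)) (Suc J) = (- 1 - of_nat k) * (pochhammer (- of_nat k) J :: 'a)"
      by (simp add: pochhammer_rec algebra_simps)
    have "(\<alpha> + of_nat k) * pochhammer (\<alpha> + of_nat (Suc k)) (Suc J) = pochhammer (\<alpha> + of_nat k) (Suc (Suc J))"
      by (simp add: pochhammer_rec[of _ "Suc J"] add_ac)
    also have "\<dots> = pochhammer (\<alpha> + of_nat k) (Suc J) * (\<alpha> + of_nat k + of_nat (Suc J))"
      by (rule pochhammer_Suc)
    finally have q: "(\<alpha> + of_nat k) * pochhammer (\<alpha> + of_nat (Suc k)) (Suc J) = \<dots>" .
    have "(\<alpha> + of_nat k) * F (Suc k) (Suc J) = (- 1 - of_nat k) * pochhammer (- of_nat k) J * ((\<alpha> + of_nat k) * pochhammer (\<alpha> + of_nat (Suc k)) (Suc J)) * pochhammer \<theta> (Suc J)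
      / (pochhammer 1 (Suc J) * pochhammer b (Suc J) * pochhammer e (Suc J))"
      unfolding F_def r by (simp only: times_divide_eq_right times_divide_eq_left mult_ac)
    thus ?thesis unfolding q W_def by (simp only: times_divide_eq_right times_divide_eq_left mult_ac)
  qed
  have "(\<alpha> + of_nat k) * ((b + of_nat k) * (e + of_nat k) * F (Suc k) (Suc J) - (\<beta> + of_nat k) * (\<epsilon> + of_nat k) * F k (Suc J))
      = (b + of_nat k) * (e + of_nat k) * ((\<alpha> + of_nat k) * F (Suc k) (Suc J)) - (\<alpha> + of_nat k) * (\<beta> + of_nat k) * (\<epsilon> + of_nat k) * F k (Suc J)"
    by (simp add: algebra_simps)
  note eq = this
  show ?case
    unfolding sum.atMost_Suc ih g eq
    unfolding f1 f2
    unfolding \<beta> \<epsilon> \<theta> of_nat_Suc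
    by (simp add: algebra_simps)
qed

text \<open>Both sides satisfy the same recurrence in \<open>k\<close>: the boundary term of the
  telescoping contains \<open>(-k)_(k+1) = 0\<close>, and the multiplier \<open>\<alpha> + k\<close>
  is cancelled by means of \<open>(\<alpha>)_(k+1) \<noteq> 0\<close>.\<close>

lemma saalschuetz:
  fixes \<alpha> \<beta> \<epsilon> :: "'a::field"
  assumes "pochhammer 1 k \<noteq> (0::'a)" "pochhammer (1 + \<alpha> - \<beta>) k \<noteq> 0" "pochhammer (1 + \<alpha> - \<epsilon>) k \<noteq> 0"
    "pochhammer \<alpha> k \<noteq> 0"
  shows "(\<Sum>j\<le>k. pochhammer (- of_nat k) j * pochhammer (\<alpha> + of_nat k) j * pochhammer (1 + \<alpha> - \<beta> - \<epsilon>) j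
        / (pochhammer 1 j * pochhammer (1 + \<alpha> - \<beta>) j * pochhammer (1 + \<alpha> - \<epsilon>) j))
    = pochhammer \<beta> k * pochhammer \<epsilon> k / (pochhammer (1 + \<alpha> - \<beta>) k * pochhammer (1 + \<alpha> - \<epsilon>) k)"
  using assms
proof (induction k)
  case 0
  show ?case by simp
next
  case (Suc k)
  define F where "F = (\<lambda>k j. pochhammer (- of_nat k) j * pochhammer (\<alpha> + of_nat k) j * pochhammer (1 + \<alpha> - \<beta> - \<epsilon>) j
        / (pochhammer 1 j * pochhammer (1 + \<alpha> - \<beta>) j * pochhammer (1 + \<alpha> - \<epsilon>) j))"
  let ?c = "(1 + \<alpha> - \<beta> + of_nat k) * (1 + \<alpha> - \<epsilon> + of_nat k)"
  let ?d = "(\<beta> + of_nat k) * (\<epsilon> + of_nat k)"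
  have nz: "?c \<noteq> 0" "\<alpha> + of_nat k \<noteq> 0"
    and prems: "pochhammer 1 k \<noteq> (0::'a)" "pochhammer (1 + \<alpha> - \<beta>) k \<noteq> 0" "pochhammer (1 + \<alpha> - \<epsilon>) k \<noteq> 0"
      "pochhammer \<alpha> k \<noteq> 0"
    using Suc.prems by (simp_all add: pochhammer_Suc)
  have e: "\<beta> = 1 + \<alpha> - (1 + \<alpha> - \<beta>)" "\<epsilon> = 1 + \<alpha> - (1 + \<alpha> - \<epsilon>)"
      "1 + \<alpha> - \<beta> - \<epsilon> = (1 + \<alpha> - \<beta>) + (1 + \<alpha> - \<epsilon>) - 1 - \<alpha>"
    by simp_all
  have "(\<alpha> + of_nat k) * (?c * (\<Sum>j\<le>Suc k. F (Suc k) j) - ?d * (\<Sum>j\<le>Suc k. F k j)) = (\<Sum>j\<le>Suc k. (\<alpha> + of_nat k) * (?c * F (Suc k) j - ?d * F k j))"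
    by (simp only: sum_subtractf[symmetric] sum_distrib_left)
  also have "\<dots> = 0"
    unfolding F_def saalschuetz_telescope[OF Suc.prems(1-3) e]
    by (simp add: pochhammer_of_nat_eq_0_lemma)
  finally have "?c * (\<Sum>j\<le>Suc k. F (Suc k) j) = ?d * (\<Sum>j\<le>Suc k. F k j)"
    using nz by simp
  also have "(\<Sum>j\<le>Suc k. F k j) = (\<Sum>j\<le>k. F k j)"
    by (simp add: F_def pochhammer_of_nat_eq_0_lemma)
  also have "(\<Sum>j\<le>k. F k j) = pochhammer \<beta> k * pochhammer \<epsilon> k / (pochhammer (1 + \<alpha> - \<beta>) k * pochhammer (1 + \<alpha> - \<epsilon>) k)"
    unfolding F_def by (rule Suc.IH[OF prems])
  finally have "?c * (\<Sum>j\<le>Suc k. F (Suc k) j) = ?d * \<dots>" .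
  hence *: "(\<Sum>j\<le>Suc k. F (Suc k) j) = ?d * (pochhammer \<beta> k * pochhammer \<epsilon> k / (pochhammer (1 + \<alpha> - \<beta>) k * pochhammer (1 + \<alpha> - \<epsilon>) k)) / ?c"
    by (metis nz(1) nonzero_mult_div_cancel_left)
  show ?case
    unfolding *[unfolded F_def] pochhammer_Suc[of \<beta> k] pochhammer_Suc[of \<epsilon> k] pochhammer_Suc[of "1 + \<alpha> - \<beta>" k]
      pochhammer_Suc[of "1 + \<alpha> - \<epsilon>" k]
    by (simp add: ac_simps)
qed


text \<open>
  Whipple's transformation: Saalschuetz's theorem expands the two ratios in \<open>\<beta>\<close> and \<open>\<epsilon>\<close>, and after
  exchanging the sums the inner one is a 5F4 with parameters shifted by \<open>j\<close>.
\<close>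

lemma whipple_inner_sum:
  fixes \<alpha> \<gamma> \<delta> :: "'a::field"
  assumes "pochhammer 1 n \<noteq> (0::'a)" "pochhammer (1 + \<alpha>) (2 * n) \<noteq> 0"
    "pochhammer (1 + \<alpha> - \<gamma>) n \<noteq> 0" "pochhammer (1 + \<alpha> - \<delta>) n \<noteq> 0" and "j \<le> n"
  shows "(\<Sum>k\<le>n. pochhammer \<alpha> k * (\<alpha> + 2 * of_nat k) * pochhammer \<gamma> k * pochhammer \<delta> k * pochhammer (- of_nat n) k
      / (pochhammer 1 k * pochhammer (1 + \<alpha> - \<gamma>) k * pochhammer (1 + \<alpha> - \<delta>) k * pochhammer (1 + \<alpha> + of_nat n) k)
      * (pochhammer (- of_nat k) j * pochhammer (\<alpha> + of_nat k) j))
    = (-1) ^ j * pochhammer \<gamma> j * pochhammer \<delta> j * pochhammer (- of_nat n) j * pochhammer (1 + \<alpha> - \<gamma> - \<delta>) (n - j) 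
      * pochhammer \<alpha> (Suc n) / (pochhammer (1 + \<alpha> - \<gamma>) n * pochhammer (1 + \<alpha> - \<delta>) n)"
proof -
  define c where "c = (\<lambda>k. pochhammer \<alpha> k * (\<alpha> + 2 * of_nat k) * pochhammer \<gamma> k * pochhammer \<delta> k * pochhammer (- of_nat n) k
      / (pochhammer 1 k * pochhammer (1 + \<alpha> - \<gamma>) k * pochhammer (1 + \<alpha> - \<delta>) k * pochhammer (1 + \<alpha> + of_nat n) k)
      * (pochhammer (- of_nat k) j * pochhammer (\<alpha> + of_nat k) j))"
  \<comment> \<open>For \<open>k = j + i\<close> one has \<open>(\<alpha>)_k (\<alpha> + k)_j =
    (\<alpha>)_(2j) (\<alpha> + 2j)_i\<close> and
    \<open>\<alpha> + 2k = (\<alpha> + 2j) + 2i\<close>. So the base moves by \<open>2j\<close>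
    while \<open>\<gamma>\<close>, \<open>\<delta>\<close> and their lower partners move by
    \<open>j\<close>.\<close>
  define \<alpha>' where "\<alpha>' = \<alpha> + of_nat (2 * j)"
  define \<gamma>' where "\<gamma>' = \<gamma> + of_nat j"
  define \<delta>' where "\<delta>' = \<delta> + of_nat j"
  define m where "m = n - j"
  have n: "n = j + m" using \<open>j \<le> n\<close> by (simp add: m_def)
  define t where "t = (\<lambda>k. pochhammer \<alpha>' k * (\<alpha>' + 2 * of_nat k) * pochhammer \<gamma>' k * pochhammer \<delta>' k * pochhammer (- of_nat m) k
      / (pochhammer 1 k * pochhammer (1 + \<alpha>' - \<gamma>') k * pochhammer (1 + \<alpha>' - \<delta>') k * pochhammer (1 + \<alpha>' + of_nat m) k))"
  define D where "D = (-1) ^ j * pochhammer \<alpha> (2 * j) * pochhammer \<gamma> j * pochhammer \<delta> j * pochhammer (- of_nat n) j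
      / (pochhammer (1 + \<alpha> - \<gamma>) j * pochhammer (1 + \<alpha> - \<delta>) j * pochhammer (1 + \<alpha> + of_nat n) j)"
  have shifts: "1 + \<alpha>' - \<gamma>' = 1 + \<alpha> - \<gamma> + of_nat j" "1 + \<alpha>' - \<delta>' = 1 + \<alpha> - \<delta> + of_nat j"
     "1 + \<alpha>' + of_nat m = 1 + \<alpha> + of_nat n + of_nat j" "- of_nat m = - of_nat n + (of_nat j :: 'a)"
     "1 + \<alpha>' - \<gamma>' - \<delta>' = 1 + \<alpha> - \<gamma> - \<delta>" "1 + \<alpha>' = 1 + \<alpha> + of_nat (2 * j)"
    by (simp_all add: \<alpha>'_def \<gamma>'_def \<delta>'_def n)
  have term_eq: "c (j + i) = D * t i" if i: "i \<le> m" for i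
  proof -
    have nz: "pochhammer 1 (j + i) \<noteq> (0::'a)" "pochhammer 1 i \<noteq> (0::'a)"
      using pochhammer_nonzero_mono[OF assms(1)] i by (simp_all add: n)
    have f: "pochhammer (- of_nat (j + i)) j * pochhammer 1 i = (-1) ^ j * (pochhammer 1 (j + i) :: 'a)"
    proof -
      have "of_nat (j + i) - of_nat j + 1 = 1 + (of_nat i :: 'a)" by simp
      thus ?thesis
        unfolding pochhammer_minus add.commute[of j i] pochhammer_product'[of 1 i j] by (simp add: ac_simps)
    qed
    hence f: "pochhammer (- of_nat (j + i)) j / pochhammer 1 (j + i) = (-1) ^ j / (pochhammer 1 i :: 'a)"
      using nz by (simp add: frac_eq_eq ac_simps)
    have a: "pochhammer \<alpha> (j + i) * pochhammer (\<alpha> + of_nat (j + i)) j = pochhammer \<alpha> (2 * j) * pochhammer \<alpha>' i"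
      unfolding \<alpha>'_def pochhammer_product'[symmetric] by (rule arg_cong[where f = "pochhammer \<alpha>"]) simp
    have "c (j + i) = (pochhammer \<alpha> (j + i) * pochhammer (\<alpha> + of_nat (j + i)) j)
        * (pochhammer (- of_nat (j + i)) j / pochhammer 1 (j + i))
        * (\<alpha> + 2 * of_nat (j + i)) * pochhammer \<gamma> (j + i) * pochhammer \<delta> (j + i) * pochhammer (- of_nat n) (j + i)
        / (pochhammer (1 + \<alpha> - \<gamma>) (j + i) * pochhammer (1 + \<alpha> - \<delta>) (j + i) * pochhammer (1 + \<alpha> + of_nat n) (j + i))"
      by (simp add: c_def ac_simps)
    also have "\<alpha> + 2 * of_nat (j + i) = \<alpha>' + 2 * of_nat i"
      by (simp add: \<alpha>'_def)
    finally show ?thesis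
      unfolding a f D_def t_def shifts(1-4)
      unfolding \<gamma>'_def \<delta>'_def pochhammer_product'[of _ j i]
      by (simp add: ac_simps)
  qed
  \<comment> \<open>Terms with \<open>k < j\<close> vanish because
    \<open>(-k)_j = 0\<close>.\<close>
  have "(\<Sum>k\<le>n. c k) = (\<Sum>k\<in>{j..j + m}. c k)"
    by (rule sum.mono_neutral_right) (auto simp: n c_def pochhammer_of_nat_eq_0_lemma)
  also have "\<dots> = (\<Sum>i\<le>m. c (j + i))"
    by (rule sum.reindex_bij_witness[of _ "\<lambda>i. j + i" "\<lambda>k. k - j"]) auto
  also have "\<dots> = D * (\<Sum>i\<le>m. t i)"
    by (simp add: term_eq sum_distrib_left)
  also have "(\<Sum>i\<le>m. t i) = pochhammer \<alpha>' (Suc m) * pochhammer (1 + \<alpha> - \<gamma> - \<delta>) m / (pochhammer (1 + \<alpha>' - \<gamma>') m * pochhammer (1 + \<alpha>' - \<delta>') m)"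
    unfolding t_def shifts(5)[symmetric]
  proof (rule dougall_5F4)
    show "pochhammer 1 m \<noteq> (0::'a)" using pochhammer_nonzero_mono[OF assms(1)] by (simp add: n)
    show "pochhammer (1 + \<alpha>') (2 * m) \<noteq> 0"
      unfolding shifts(6) by (rule pochhammer_nonzero_shift[OF assms(2)]) (simp add: n)
    show "pochhammer (1 + \<alpha>' - \<gamma>') m \<noteq> 0" "pochhammer (1 + \<alpha>' - \<delta>') m \<noteq> 0"
      unfolding shifts(1,2) by (auto intro!: pochhammer_nonzero_shift[OF assms(3)] pochhammer_nonzero_shift[OF assms(4)] simp: n)
  qed
  also have "D * \<dots> = (-1) ^ j * (pochhammer \<alpha> (2 * j) * pochhammer \<alpha>' (Suc m)) / pochhammer (1 + \<alpha> + of_nat n) j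
      * pochhammer \<gamma> j * pochhammer \<delta> j * pochhammer (- of_nat n) j * pochhammer (1 + \<alpha> - \<gamma> - \<delta>) m
      / (pochhammer (1 + \<alpha> - \<gamma>) n * pochhammer (1 + \<alpha> - \<delta>) n)"
    unfolding D_def shifts(1,2) unfolding n pochhammer_product'[of _ j m] by (simp add: ac_simps)
  \<comment> \<open>Both sides equal \<open>(\<alpha>)_(n+1+j)\<close>; the regrouping exposes the
    factor \<open>(1 + \<alpha> + n)_j\<close> that cancels the denominator left by
    \<open>D\<close>.\<close>
  also have "pochhammer \<alpha> (2 * j) * pochhammer \<alpha>' (Suc m) = pochhammer \<alpha> (Suc n) * pochhammer (\<alpha> + of_nat (Suc n)) j"
    unfolding \<alpha>'_def pochhammer_product'[symmetric] by (rule arg_cong[where f = "pochhammer \<alpha>"]) (simp add: n)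
  also have "\<alpha> + of_nat (Suc n) = 1 + \<alpha> + of_nat n"
    by simp
  also have "(-1) ^ j * (pochhammer \<alpha> (Suc n) * pochhammer (1 + \<alpha> + of_nat n) j) / pochhammer (1 + \<alpha> + of_nat n) j
     = (-1) ^ j * pochhammer \<alpha> (Suc n)"
    using pochhammer_nonzero_shift[OF assms(2), of n j] \<open>j \<le> n\<close> by simp
  finally show ?thesis
    unfolding c_def m_def by (simp add: ac_simps)
qed

text \<open>The usual 4F3 has \<open>(\<gamma> + \<delta> - \<alpha> - n)_j\<close> in the
  denominator and \<open>(1 + \<alpha> - \<gamma> - \<delta>)_n\<close> in front. Merged into
  \<open>(-1)^j (1 + \<alpha> - \<gamma> - \<delta>)_(n-j)\<close>, they form a numerator whose
  divisibility by \<open>p\<close> can be used term by term.\<close>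

lemma whipple_7F6:
  fixes \<alpha> \<beta> \<gamma> \<delta> \<epsilon> :: "'a::field"
  assumes nz: "pochhammer 1 n \<noteq> (0::'a)" "pochhammer (1 + \<alpha>) (2 * n) \<noteq> 0" "pochhammer \<alpha> n \<noteq> 0"
    "pochhammer (1 + \<alpha> - \<beta>) n \<noteq> 0" "pochhammer (1 + \<alpha> - \<gamma>) n \<noteq> 0" "pochhammer (1 + \<alpha> - \<delta>) n \<noteq> 0"
    "pochhammer (1 + \<alpha> - \<epsilon>) n \<noteq> 0"
  shows "(\<Sum>k\<le>n. pochhammer \<alpha> k * (\<alpha> + 2 * of_nat k) * pochhammer (- of_nat n) k / (pochhammer 1 k * pochhammer (1 + \<alpha> + of_nat n) k)
        * (pochhammer \<beta> k / pochhammer (1 + \<alpha> - \<beta>) k) * (pochhammer \<gamma> k / pochhammer (1 + \<alpha> - \<gamma>) k)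
        * (pochhammer \<delta> k / pochhammer (1 + \<alpha> - \<delta>) k) * (pochhammer \<epsilon> k / pochhammer (1 + \<alpha> - \<epsilon>) k))
    = pochhammer \<alpha> (Suc n) / (pochhammer (1 + \<alpha> - \<gamma>) n * pochhammer (1 + \<alpha> - \<delta>) n)
      * (\<Sum>j\<le>n. (-1) ^ j * pochhammer (1 + \<alpha> - \<beta> - \<epsilon>) j * pochhammer \<gamma> j * pochhammer \<delta> j * pochhammer (- of_nat n) j 
          * pochhammer (1 + \<alpha> - \<gamma> - \<delta>) (n - j) / (pochhammer 1 j * pochhammer (1 + \<alpha> - \<beta>) j * pochhammer (1 + \<alpha> - \<epsilon>) j))"
    (is "?L = ?R")
proof -
  define c where "c = (\<lambda>k. pochhammer \<alpha> k * (\<alpha> + 2 * of_nat k) * pochhammer \<gamma> k * pochhammer \<delta> k * pochhammer (- of_nat n) k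
      / (pochhammer 1 k * pochhammer (1 + \<alpha> - \<gamma>) k * pochhammer (1 + \<alpha> - \<delta>) k * pochhammer (1 + \<alpha> + of_nat n) k))"
  define w where "w = (\<lambda>j. pochhammer (1 + \<alpha> - \<beta> - \<epsilon>) j / (pochhammer 1 j * pochhammer (1 + \<alpha> - \<beta>) j * pochhammer (1 + \<alpha> - \<epsilon>) j))"
  have s: "pochhammer \<beta> k * pochhammer \<epsilon> k / (pochhammer (1 + \<alpha> - \<beta>) k * pochhammer (1 + \<alpha> - \<epsilon>) k)
      = (\<Sum>j\<le>n. (pochhammer (- of_nat k) j * pochhammer (\<alpha> + of_nat k) j) * w j)" if "k \<le> n" for k
  proof -
    \<comment> \<open>Since \<open>(-k)_j = 0\<close> for \<open>j > k\<close>, the range can be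
      made independent of \<open>k\<close>, so that the two sums can be exchanged.\<close>
    have "(\<Sum>j\<le>n. (pochhammer (- of_nat k) j * pochhammer (\<alpha> + of_nat k) j) * w j) =
        (\<Sum>j\<le>k. (pochhammer (- of_nat k) j * pochhammer (\<alpha> + of_nat k) j) * w j)"
      by (rule sum.mono_neutral_right) (use that in \<open>auto simp: pochhammer_of_nat_eq_0_lemma\<close>)
    also have "\<dots> = pochhammer \<beta> k * pochhammer \<epsilon> k / (pochhammer (1 + \<alpha> - \<beta>) k * pochhammer (1 + \<alpha> - \<epsilon>) k)"
      unfolding w_def times_divide_eq_right
      by (rule saalschuetz; rule pochhammer_nonzero_mono[OF _ that]; rule nz)
    finally show ?thesis by simp
  qed
  have "?L = (\<Sum>k\<le>n. c k * (pochhammer \<beta> k * pochhammer \<epsilon> k / (pochhammer (1 + \<alpha> - \<beta>) k * pochhammer (1 + \<alpha> - \<epsilon>) k)))"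
    by (rule sum.cong[OF refl]) (simp add: c_def ac_simps)
  also have "\<dots> = (\<Sum>k\<le>n. \<Sum>j\<le>n. c k * (pochhammer (- of_nat k) j * pochhammer (\<alpha> + of_nat k) j) * w j)"
    by (rule sum.cong[OF refl]) (simp add: s sum_distrib_left mult.assoc)
  also have "\<dots> = (\<Sum>j\<le>n. (\<Sum>k\<le>n. c k * (pochhammer (- of_nat k) j * pochhammer (\<alpha> + of_nat k) j)) * w j)"
    by (subst sum.swap) (simp add: sum_distrib_right)
  also have "\<dots> = ?R"
    unfolding sum_distrib_left c_def
    by (rule sum.cong[OF refl], subst whipple_inner_sum[OF nz(1,2,5,6)]) (simp_all add: w_def ac_simps)
  finally show ?thesis .
qed

section \<open>Reversal of terminating well-poised sums\<close>

text \<open>From \<open>(1 - n - \<zeta>)_k = (-1)^k (\<zeta> + n - k)_k\<close> the ratio becomes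
  \<open>(-1)^k (\<zeta>)_k (\<zeta>)_(n-k) / (\<zeta>)_n\<close>, which is symmetric in
  \<open>k\<close> and \<open>n - k\<close> up to sign.\<close>

lemma pochhammer_ratio_reflect:
  fixes \<zeta> :: "'a::field"
  assumes "pochhammer \<zeta> n \<noteq> 0" "k \<le> n"
  shows "pochhammer \<zeta> (n - k) / pochhammer (1 - of_nat n - \<zeta>) (n - k)
     = (-1) ^ n * (pochhammer \<zeta> k / pochhammer (1 - of_nat n - \<zeta>) k)"
proof -
  have *: "pochhammer \<zeta> k / pochhammer (1 - of_nat n - \<zeta>) k = (-1) ^ k * (pochhammer \<zeta> k * pochhammer \<zeta> (n - k)) / pochhammer \<zeta> n"
    if "k \<le> n" for k
  proof -
    have "pochhammer (1 - of_nat n - \<zeta>) k = pochhammer (- (\<zeta> + of_nat n - 1)) k"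
      by (rule arg_cong[where f = "\<lambda>x. pochhammer x k"]) simp
    also have "\<dots> = (-1) ^ k * pochhammer (\<zeta> + of_nat n - 1 - of_nat k + 1) k"
      by (rule pochhammer_minus)
    also have "\<zeta> + of_nat n - 1 - of_nat k + 1 = \<zeta> + of_nat (n - k)"
      using that by (simp add: of_nat_diff)
    finally have 1: "pochhammer (1 - of_nat n - \<zeta>) k = (-1) ^ k * pochhammer (\<zeta> + of_nat (n - k)) k" .
    have 2: "pochhammer \<zeta> n = pochhammer \<zeta> (n - k) * pochhammer (\<zeta> + of_nat (n - k)) k"
      using pochhammer_product'[of \<zeta> "n - k" k] that by simp
    have 3: "pochhammer \<zeta> (n - k) \<noteq> 0" "pochhammer (\<zeta> + of_nat (n - k)) k \<noteq> 0"
      using assms(1) unfolding 2 by auto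
    have "inverse ((- 1) ^ k) = ((- 1) ^ k :: 'a)" by (simp add: minus_one_power_iff)
    thus ?thesis using 3 unfolding 1 2 by (simp add: divide_inverse)
  qed
  have "(-1) ^ n * (-1) ^ k = ((-1) ^ (n - k) :: 'a)"
  proof -
    have "(-1) ^ n = ((-1) ^ (n - k) * (-1) ^ k :: 'a)"
      using assms(2) by (simp flip: power_add)
    moreover have "(-1) ^ k * (-1) ^ k = (1 :: 'a)"
      by (simp add: minus_one_power_iff)
    ultimately show ?thesis by (simp only: mult.assoc mult_1_right)
  qed
  note eq = this
  show ?thesis
    unfolding *[OF diff_le_self] *[OF assms(2)] diff_diff_cancel[OF assms(2)]
    unfolding eq[symmetric] by (simp only: times_divide_eq_right mult_ac)
qed

text \<open>Under \<open>k \<mapsto> n - k\<close> every ratio contributes \<open>(-1)^n\<close>; an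
  even number of them leaves no sign, while the linear factor changes its sign. The sum is therefore
  its own negative.\<close>

lemma well_poised_sum_eq_0:
  fixes \<zeta>s :: "'a::field list"
  assumes "\<And>\<zeta>. \<zeta> \<in> set \<zeta>s \<Longrightarrow> pochhammer \<zeta> n \<noteq> 0" "even (length \<zeta>s)" "(2::'a) \<noteq> 0"
  shows "(\<Sum>k\<le>n. (- of_nat n + 2 * of_nat k) * (\<Prod>\<zeta>\<leftarrow>\<zeta>s. pochhammer \<zeta> k / pochhammer (1 - of_nat n - \<zeta>) k)) = 0"
    (is "(\<Sum>k\<le>n. ?f k) = 0")
proof -
  have r: "(\<Prod>\<zeta>\<leftarrow>\<zeta>s. pochhammer \<zeta> (n - k) / pochhammer (1 - of_nat n - \<zeta>) (n - k))
      = (-1) ^ (n * length \<zeta>s) * (\<Prod>\<zeta>\<leftarrow>\<zeta>s. pochhammer \<zeta> k / pochhammer (1 - of_nat n - \<zeta>) k)" if "k \<le> n" for k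
    using assms(1)
  proof (induction \<zeta>s)
    case (Cons \<zeta> \<zeta>s)
    hence "pochhammer \<zeta> n \<noteq> 0" by simp
    from pochhammer_ratio_reflect[OF this that] show ?case
      using Cons by (simp add: power_add mult_ac del: times_divide_eq_left times_divide_eq_right)
  qed simp
  have "(\<Sum>k\<le>n. ?f k) = (\<Sum>k\<le>n. ?f (n - k))"
    by (rule sum.reindex_bij_witness[of _ "\<lambda>k. n - k" "\<lambda>k. n - k"]) auto
  also have "\<dots> = (\<Sum>k\<le>n. - ?f k)"
  proof (rule sum.cong[OF refl])
    fix k assume "k \<in> {..n}"
    hence k: "k \<le> n" by simp
    have "- of_nat n + 2 * of_nat (n - k) = - (- of_nat n + 2 * of_nat k :: 'a)"
      using k by (simp add: of_nat_diff)
    thus "?f (n - k) = - ?f k"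
      using assms(2) unfolding r[OF k] by (simp only: even_mult_iff minus_one_power_iff if_True simp_thms mult_1_left mult_minus_left)
  qed
  also have "\<dots> = - (\<Sum>k\<le>n. ?f k)" by (rule sum_negf)
  finally have "2 * (\<Sum>k\<le>n. ?f k) = 0"
    by (simp add: eq_neg_iff_add_eq_0)
  thus ?thesis using assms(3) by simp
qed

text \<open>The numerator shows that the left side is of second order: it lies in \<open>p^2\<close>
  when \<open>M\<close> and \<open>P\<close> agree with \<open>N\<close> modulo \<open>p\<close> and
  \<open>P + M\<close> agrees with \<open>2 * N\<close> modulo \<open>p^2\<close>.\<close>

lemma inverse_sum_expansion:
  fixes N P M :: "'a::field"
  assumes "N \<noteq> 0" "P \<noteq> 0" "M \<noteq> 0"
  shows "2 * inverse N - inverse M - inverse P = (N * (P + M - 2 * N) + 2 * ((M - N) * (P - N))) / (N * M * P)"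
proof -
  have "(2 * inverse N - inverse M - inverse P) * (N * M * P) = 2 * (inverse N * N) * M * P - (inverse M * M) * N * P - (inverse P * P) * N * M"
    by (simp only: algebra_simps)
  also have "\<dots> = N * (P + M - 2 * N) + 2 * ((M - N) * (P - N))"
    using assms by (simp add: algebra_simps)
  finally show ?thesis using assms by (simp add: nonzero_eq_divide_eq)
qed

subsection \<open>Fractional ideals and units of the p-adic numbers\<close>

text \<open>The fractional ideal \<open>p\<^sup>n \<int>\<^sub>p\<close>.\<close>

definition padic_ideal :: "int \<Rightarrow> 'p :: prime_card padic set" where
  "padic_ideal n = {x. of_nat CARD('p) powi (- n) * x \<in> Zp}"

lemma of_nat_eq_0_padic_iff [simp]: "of_nat m = (0 :: 'p :: prime_card padic) \<longleftrightarrow> m = 0"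
proof
  assume "of_nat m = (0 :: 'p padic)"
  hence "of_nat m = (0 :: 'p padic_int)" by (simp add: of_nat_to_fract)
  hence *: "int m mod int CARD('p) ^ n = 0" for n
    using Rep_padic_int_of_nat[of m n, where 'p = 'p] by (simp add: zero_padic_int.rep_eq)
  \<comment> \<open>The single level \<open>n = m\<close> suffices, because \<open>p^m\<close>
    exceeds \<open>m\<close>.\<close>
  have "m < 2 ^ m" by simp
  also have "\<dots> \<le> CARD('p) ^ m"
    using card_gt_1[where 'p = 'p] by (intro power_mono) auto
  finally have "int m < int CARD('p) ^ m" by (simp flip: of_nat_power)
  with *[of m] show "m = 0" by simp
qed simp

lemma to_fract_Zp [simp]: "to_fract z \<in> Zp"
  by (simp add: Zp_def)

lemma Zp_add: "x \<in> Zp \<Longrightarrow> y \<in> Zp \<Longrightarrow> x + y \<in> Zp"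
  by (auto simp: Zp_def simp flip: to_fract_add)

lemma Zp_mult: "x \<in> Zp \<Longrightarrow> y \<in> Zp \<Longrightarrow> x * y \<in> Zp"
  by (auto simp: Zp_def simp flip: to_fract_mult)

lemma Zp_uminus: "x \<in> Zp \<Longrightarrow> - x \<in> Zp"
  by (auto simp: Zp_def simp flip: to_fract_uminus)

lemma Zp_of_nat: "of_nat n \<in> Zp"
  by (simp add: of_nat_to_fract)

lemma padic_ideal_0_eq: "padic_ideal 0 = Zp"
  by (simp add: padic_ideal_def)

lemma padic_ideal_zero [simp]: "0 \<in> padic_ideal n"
  using Zp_of_nat[of 0] by (simp add: padic_ideal_def)

lemma padic_ideal_add: "x \<in> padic_ideal n \<Longrightarrow> y \<in> padic_ideal n \<Longrightarrow> x + y \<in> padic_ideal n"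
  by (simp add: padic_ideal_def distrib_left Zp_add)

lemma padic_ideal_uminus: "x \<in> padic_ideal n \<Longrightarrow> - x \<in> padic_ideal n"
  using Zp_uminus by (fastforce simp: padic_ideal_def)

lemma padic_ideal_uminus_iff: "- x \<in> padic_ideal n \<longleftrightarrow> x \<in> padic_ideal n"
  by (metis minus_minus padic_ideal_uminus)

lemma padic_ideal_diff: "x \<in> padic_ideal n \<Longrightarrow> y \<in> padic_ideal n \<Longrightarrow> x - y \<in> padic_ideal n"
  using padic_ideal_add[of x n "- y"] padic_ideal_uminus[of y n] by simp

lemma padic_ideal_mult:
  assumes "(x :: 'p :: prime_card padic) \<in> padic_ideal m" "y \<in> padic_ideal n"
  shows "x * y \<in> padic_ideal (m + n)"
proof -
  let ?q = "of_nat CARD('p) :: 'p padic"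
  have "?q powi (- (m + n)) = ?q powi (- m) * ?q powi (- n)"
    by (simp flip: power_int_add)
  hence eq: "?q powi (- (m + n)) * (x * y) = (?q powi (- m) * x) * (?q powi (- n) * y)"
    by (simp only: mult_ac)
  show ?thesis
    using assms unfolding padic_ideal_def mem_Collect_eq eq by (rule Zp_mult)
qed

lemma padic_ideal_mono:
  assumes "x \<in> padic_ideal n" "m \<le> n"
  shows "(x :: 'p :: prime_card padic) \<in> padic_ideal m"
proof -
  let ?q = "of_nat CARD('p) :: 'p padic"
  have "?q powi (- m) = ?q powi (n - m) * ?q powi (- n)"
    by (simp flip: power_int_add)
  also have "?q powi (n - m) = of_nat (CARD('p) ^ nat (n - m))"
    using assms(2) by (simp add: power_int_def)
  finally have "?q powi (- m) * x = of_nat (CARD('p) ^ nat (n - m)) * (?q powi (- n) * x)"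
    by (simp only: mult.assoc)
  moreover have "?q powi (- n) * x \<in> Zp"
    using assms(1) by (simp add: padic_ideal_def)
  ultimately show ?thesis unfolding padic_ideal_def mem_Collect_eq by (simp only: Zp_mult Zp_of_nat)
qed

lemma padic_ideal_sum: "(\<And>i. i \<in> A \<Longrightarrow> f i \<in> padic_ideal n) \<Longrightarrow> sum f A \<in> padic_ideal n"
  by (induction A rule: infinite_finite_induct) (auto intro: padic_ideal_add)

lemma padic_ideal_mult_Zp: "x \<in> padic_ideal n \<Longrightarrow> y \<in> padic_ideal 0 \<Longrightarrow> x * y \<in> padic_ideal n"
    "x \<in> padic_ideal 0 \<Longrightarrow> y \<in> padic_ideal n \<Longrightarrow> x * y \<in> padic_ideal n"
  using padic_ideal_mult[of x n y 0] padic_ideal_mult[of x 0 y n] by simp_all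

lemma padic_ideal_of_nat: "of_nat n \<in> padic_ideal 0"
  by (simp add: padic_ideal_0_eq Zp_of_nat)

lemma padic_ideal_of_int: "of_int n \<in> padic_ideal 0"
  by (cases n) (auto intro: padic_ideal_of_nat padic_ideal_uminus simp del: of_nat_Suc)

lemma padic_ideal_one: "1 \<in> padic_ideal 0"
  using padic_ideal_of_nat[of 1] by simp

lemma padic_ideal_pochhammer: "x \<in> padic_ideal 0 \<Longrightarrow> pochhammer x k \<in> padic_ideal 0"
  by (induction k) (auto simp: pochhammer_Suc intro!: padic_ideal_one padic_ideal_mult_Zp padic_ideal_add padic_ideal_of_nat)

lemma padic_cong_iff_padic_ideal:
  fixes x y :: "'p :: prime_card padic"
  shows "padic_cong n x y \<longleftrightarrow> x - y \<in> padic_ideal (int n)"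
proof -
  let ?q = "of_nat CARD('p) :: 'p padic"
  have inv: "?q powi (- int n) * (?q ^ n * z) = z" "?q ^ n * (?q powi (- int n) * z) = z" for z
    by (simp_all add: power_int_minus)
  show ?thesis
    unfolding padic_cong_def padic_ideal_def mem_Collect_eq
    by (metis (no_types, lifting) image_iff inv)
qed

lemma of_nat_padic_ideal_1_iff:
  "(of_nat m :: 'p :: prime_card padic) \<in> padic_ideal 1 \<longleftrightarrow> CARD('p) dvd m"
proof -
  have "(of_nat m :: 'p padic) \<in> padic_ideal 1 \<longleftrightarrow> padic_cong 1 (to_fract (of_nat m)) (to_fract (of_nat 0 :: 'p padic_int))"
    by (simp add: padic_cong_iff_padic_ideal of_nat_to_fract)
  also have "\<dots> \<longleftrightarrow> int m mod int CARD('p) = 0"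
    unfolding padic_cong_1_to_fract_iff Rep_padic_int_of_nat by simp
  finally show ?thesis by (simp add: mod_eq_0_iff_dvd)
qed

lemma of_int_padic_ideal_1_iff:
  "(of_int m :: 'p :: prime_card padic) \<in> padic_ideal 1 \<longleftrightarrow> int CARD('p) dvd m"
proof (cases m)
  case (nonneg n)
  thus ?thesis using of_nat_padic_ideal_1_iff[of n, where 'p = 'p] by simp
next
  case (neg n)
  have "(- of_nat (Suc n) :: 'p padic) \<in> padic_ideal 1 \<longleftrightarrow> of_nat (Suc n) \<in> (padic_ideal 1 :: 'p padic set)"
    by (rule padic_ideal_uminus_iff)
  thus ?thesis using neg of_nat_padic_ideal_1_iff[of "Suc n", where 'p = 'p] by (simp del: of_nat_Suc)
qed

section \<open>Units of the p-adic integers\<close>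

text \<open>A nonzero residue modulo \<open>p\<close> makes every component coprime to
  \<open>p^n\<close>. Inverses modulo \<open>p^n\<close> are unique, so their reduced
  representatives are compatible and form a p-adic integer.\<close>

lemma padic_int_unit:
  assumes "Rep_padic_int (z :: 'p :: prime_card padic_int) 1 \<noteq> 0"
  shows "\<exists>w. z * w = 1"
proof -
  let ?q = "int CARD('p)"
  have q: "prime ?q" "?q > 1" using prime_card[where 'a = 'p] card_gt_1 by auto
  have le: "Rep_padic_int z m mod ?q ^ n = Rep_padic_int z n" if "n \<le> m" for m n
    by (rule compat_mod_le[OF Rep_padic_int_compat that])
  have "\<not> ?q dvd Rep_padic_int z (Suc n)" for n
    using le[of 1 "Suc n"] assms by (auto simp: dvd_eq_mod_eq_0)
  hence "coprime (Rep_padic_int z n) (?q ^ n)" for n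
    using q by (cases n) (auto simp: coprime_commute prime_imp_coprime)
  hence "\<forall>n. \<exists>x. [Rep_padic_int z n * x = 1] (mod ?q ^ n)"
    using cong_solve_coprime_int by blast
  then obtain x where x: "[Rep_padic_int z n * x n = 1] (mod ?q ^ n)" for n by metis
  define f where "f n = x n mod ?q ^ n" for n
  have f: "[Rep_padic_int z n * f n = 1] (mod ?q ^ n)" for n
    using x[of n] by (simp add: f_def cong_def mod_mult_right_eq)
  have "f (Suc n) mod ?q ^ n = f n" for n
  proof -
    have "[Rep_padic_int z (Suc n) * f (Suc n) = 1] (mod ?q ^ n)"
      using f[of "Suc n"] by (rule cong_dvd_modulus) (simp add: le_imp_power_dvd)
    moreover have "[Rep_padic_int z (Suc n) = Rep_padic_int z n] (mod ?q ^ n)"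
      using le[of n "Suc n"] le[of n n] by (simp add: cong_def)
    ultimately have 1: "[Rep_padic_int z n * f (Suc n) = 1] (mod ?q ^ n)"
      by (meson cong_mult cong_refl cong_sym cong_trans)
    \<comment> \<open>Uniqueness of the inverse: with \<open>z\<close> for its component at level
      \<open>n\<close>, the product \<open>f n * z * f (Suc n)\<close> is congruent to either outer
      factor.\<close>
    have "[f (Suc n) = f n * (Rep_padic_int z n * f (Suc n))] (mod ?q ^ n)"
      using cong_mult[OF cong_sym[OF f[of n]] cong_refl[of "f (Suc n)"]] by (simp add: ac_simps)
    also have "[f n * (Rep_padic_int z n * f (Suc n)) = f n * 1] (mod ?q ^ n)"
      by (rule cong_mult[OF cong_refl 1])
    finally show ?thesis by (simp add: cong_def f_def)
  qed
  hence "Rep_padic_int (Abs_padic_int f :: 'p padic_int) = f"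
    by (intro Abs_padic_int_inverse) blast
  hence "Rep_padic_int (z * Abs_padic_int f) = Rep_padic_int (1 :: 'p padic_int)"
    using f by (auto simp: times_padic_int.rep_eq one_padic_int.rep_eq cong_def)
  thus ?thesis by (metis Rep_padic_int_inject)
qed

text \<open>The last conjunct excludes 0, whose inverse is 0 in HOL and thus integral.\<close>

definition padic_unit :: "'p :: prime_card padic \<Rightarrow> bool" where
  "padic_unit x \<longleftrightarrow> x \<in> padic_ideal 0 \<and> inverse x \<in> padic_ideal 0 \<and> x \<noteq> 0"

lemma padic_unitI:
  assumes "x \<in> padic_ideal 0" "x \<notin> padic_ideal 1"
  shows "padic_unit (x :: 'p :: prime_card padic)"
proof -
  obtain z where z: "x = to_fract z" using assms(1) by (auto simp: padic_ideal_0_eq Zp_def)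
  have "\<not> padic_cong 1 (to_fract z) (to_fract 0)"
    using assms(2) by (simp add: z padic_cong_iff_padic_ideal)
  hence "Rep_padic_int z 1 \<noteq> 0"
    unfolding padic_cong_1_to_fract_iff by (simp add: zero_padic_int.rep_eq)
  then obtain w where "z * w = 1" using padic_int_unit by blast
  hence "x * to_fract w = 1" by (simp add: z flip: to_fract_mult)
  hence "inverse x = to_fract w" by (metis inverse_unique)
  thus ?thesis using assms by (auto simp: padic_unit_def padic_ideal_0_eq)
qed

lemma padic_unit_mult: "padic_unit x \<Longrightarrow> padic_unit y \<Longrightarrow> padic_unit (x * y)"
  unfolding padic_unit_def using padic_ideal_mult_Zp(1)[of _ 0] by auto

lemma padic_unit_one: "padic_unit 1"
  by (simp add: padic_unit_def padic_ideal_one)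

lemma padic_unit_nonzero: "padic_unit x \<Longrightarrow> x \<noteq> 0"
  by (simp add: padic_unit_def)

lemma padic_ideal_divide_unit: "x \<in> padic_ideal n \<Longrightarrow> padic_unit u \<Longrightarrow> x / u \<in> padic_ideal n"
  unfolding padic_unit_def divide_inverse by (blast intro: padic_ideal_mult_Zp)

lemma padic_ideal_cancel_unit:
  assumes "u * x \<in> padic_ideal n" "padic_unit u"
  shows "x \<in> padic_ideal n"
  using padic_ideal_divide_unit[OF assms] assms(2) by (simp add: padic_unit_def)

lemma padic_unit_cong_int:
  assumes "x - of_int m \<in> padic_ideal 1" "\<not> int CARD('p) dvd m"
  shows "padic_unit (x :: 'p :: prime_card padic)"
proof (rule padic_unitI)
  show "x \<in> padic_ideal 0"
    using padic_ideal_add[OF padic_ideal_mono[OF assms(1)] padic_ideal_of_int[of m]] by simp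
  show "x \<notin> padic_ideal 1"
    using padic_ideal_diff[of x 1 "x - of_int m"] assms of_int_padic_ideal_1_iff[of m, where 'p = 'p] by auto
qed

lemma padic_unit_pochhammer:
  assumes "x - of_int m \<in> padic_ideal 1" "\<And>i. i < k \<Longrightarrow> \<not> int CARD('p) dvd m + int i"
  shows "padic_unit (pochhammer (x :: 'p :: prime_card padic) k)"
  using assms(2)
proof (induction k)
  case (Suc k)
  have "padic_unit (x + of_nat k)"
    using assms(1) Suc.prems by (intro padic_unit_cong_int[of _ "m + int k"]) auto
  thus ?case using Suc by (auto simp: pochhammer_Suc intro: padic_unit_mult)
qed (simp add: padic_unit_one)

lemma padic_ideal_1_pochhammer:
  assumes "x - of_int m \<in> padic_ideal 1" "i < k" "int CARD('p) dvd m + int i"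
  shows "pochhammer (x :: 'p :: prime_card padic) k \<in> padic_ideal 1"
proof -
  have x: "x \<in> padic_ideal 0"
    using padic_ideal_add[OF padic_ideal_mono[OF assms(1)] padic_ideal_of_int[of m]] by simp
  have "x + of_nat i = (x - of_int m) + of_int (m + int i)" by simp
  also have "\<dots> \<in> padic_ideal 1"
    by (rule padic_ideal_add[OF assms(1)]) (use assms(3) in \<open>simp only: of_int_padic_ideal_1_iff\<close>)
  finally have "x + of_nat i \<in> padic_ideal 1" .
  moreover have "pochhammer x k = pochhammer x i * (x + of_nat i) * pochhammer (x + of_nat (Suc i)) (k - Suc i)"
    using assms(2) by (subst pochhammer_product[of "Suc i" k]) (simp_all add: pochhammer_Suc)
  moreover have "pochhammer x i \<in> padic_ideal 0" "pochhammer (x + of_nat (Suc i)) (k - Suc i) \<in> padic_ideal 0"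
    by (intro padic_ideal_pochhammer padic_ideal_add x padic_ideal_of_nat)+
  ultimately show ?thesis
    by (simp only: padic_ideal_mult_Zp)
qed

lemma residue_props:
  assumes "(x :: 'p :: prime_card padic) \<in> Zp"
  shows "residue x < CARD('p)" "x - of_nat (residue x) \<in> padic_ideal 1"
  using theI'[OF ex1_residue[OF assms]] unfolding residue_def[symmetric]
  by (auto simp: padic_cong_iff_padic_ideal)

text \<open>The valuation of \<open>x\<close> is 0 or 1, so inversion loses at most one factor
  \<open>p\<close>. This is how hypothesis (iv) is exploited.\<close>

lemma inverse_padic_ideal_minus_1:
  assumes "x \<in> padic_ideal 0" "x \<notin> padic_ideal 2"
  shows "inverse (x :: 'p :: prime_card padic) \<in> padic_ideal (- 1)"
proof (cases "x \<in> padic_ideal 1")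
  case False
  with assms(1) have "padic_unit x" by (rule padic_unitI)
  thus ?thesis by (auto simp: padic_unit_def intro: padic_ideal_mono)
next
  case True
  let ?q = "of_nat CARD('p) :: 'p padic"
  have "padic_unit (x / ?q)"
  proof (rule padic_unitI)
    show "x / ?q \<in> padic_ideal 0" using True by (simp add: padic_ideal_def field_simps)
    show "x / ?q \<notin> padic_ideal 1" using assms(2) by (simp add: padic_ideal_def power_int_minus field_simps power2_eq_square)
  qed
  hence "inverse ?q * inverse (x / ?q) \<in> padic_ideal (- 1 + 0)"
    by (intro padic_ideal_mult) (auto simp: padic_unit_def padic_ideal_def Zp_of_nat[of 1, simplified])
  thus ?thesis by (simp add: inverse_eq_divide)
qed

section \<open>Congruences modulo p and expansions modulo p^2\<close>

lemma padic_cong_1_mult: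
  assumes "x - x' \<in> padic_ideal 1" "y - y' \<in> padic_ideal 1" "x \<in> padic_ideal 0" "y' \<in> padic_ideal 0"
  shows "x * y - x' * y' \<in> padic_ideal 1"
proof -
  have "x * (y - y') + (x - x') * y' \<in> padic_ideal 1"
    using padic_ideal_mult_Zp(2)[OF assms(3,2)] padic_ideal_mult_Zp(1)[OF assms(1,4)] by (rule padic_ideal_add)
  thus ?thesis by (simp add: algebra_simps)
qed

lemma padic_cong_1_inverse:
  assumes "x - y \<in> padic_ideal 1" "padic_unit x" "padic_unit y"
  shows "inverse x - inverse y \<in> padic_ideal 1"
proof -
  have "- (inverse x * (x - y) * inverse y) \<in> padic_ideal 1"
    using assms by (auto simp: padic_unit_def intro!: padic_ideal_uminus padic_ideal_mult_Zp(1)[of _ _ "inverse y"] padic_ideal_mult_Zp(2)[of "inverse x"])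
  thus ?thesis
    using assms(2,3) by (simp add: inverse_diff_inverse padic_unit_nonzero)
qed

lemma padic_cong_1_divide:
  assumes "x - x' \<in> padic_ideal 1" "y - y' \<in> padic_ideal 1" "x \<in> padic_ideal 0" "padic_unit y" "padic_unit y'"
  shows "x / y - x' / y' \<in> padic_ideal 1"
  unfolding divide_inverse using assms
  by (intro padic_cong_1_mult padic_cong_1_inverse) (auto simp: padic_unit_def)

lemma padic_cong_1_pochhammer:
  assumes "x - y \<in> padic_ideal 1" "x \<in> padic_ideal 0" "y \<in> padic_ideal 0"
  shows "pochhammer x k - pochhammer y k \<in> padic_ideal 1"
proof (induction k)
  case (Suc k)
  thus ?case unfolding pochhammer_Suc
    by (intro padic_cong_1_mult)
      (use assms in \<open>auto intro!: padic_ideal_pochhammer padic_ideal_add padic_ideal_of_nat\<close>)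
qed simp

text \<open>The terms linear in \<open>x\<close> cancel between \<open>1 + x\<close> and
  \<open>1 - x\<close>. In the induction they survive only as \<open>(?P - ?M) * x\<close>, a
  product of two multiples of \<open>p\<close>.\<close>

lemma pochhammer_add_padic_ideal_2:
  assumes "x \<in> padic_ideal 1"
  shows "pochhammer (1 + x) k + pochhammer (1 - x) k - 2 * pochhammer 1 k \<in> padic_ideal 2"
proof (induction k)
  case (Suc k)
  let ?P = "pochhammer (1 + x) k" and ?M = "pochhammer (1 - x) k" and ?N = "pochhammer 1 k"
  have x: "x \<in> padic_ideal 0" using assms by (rule padic_ideal_mono) simp
  have "(1 + x) - (1 - x) = x + x" by simp
  hence "(1 + x) - (1 - x) \<in> padic_ideal 1"
    using padic_ideal_add[OF assms assms] by (simp only:)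
  hence "?P - ?M \<in> padic_ideal 1"
    by (rule padic_cong_1_pochhammer) (intro padic_ideal_add padic_ideal_diff padic_ideal_one x)+
  hence "(?P - ?M) * x \<in> padic_ideal (1 + 1)"
    using assms by (rule padic_ideal_mult)
  moreover have "(?P + ?M - 2 * ?N) * (1 + of_nat k) \<in> padic_ideal 2"
    using padic_ideal_mult_Zp(1)[OF Suc.IH padic_ideal_add[OF padic_ideal_one padic_ideal_of_nat]] .
  ultimately have "(?P + ?M - 2 * ?N) * (1 + of_nat k) + (?P - ?M) * x \<in> padic_ideal 2"
    by (intro padic_ideal_add) simp_all
  also have "(?P + ?M - 2 * ?N) * (1 + of_nat k) + (?P - ?M) * x =
      pochhammer (1 + x) (Suc k) + pochhammer (1 - x) (Suc k) - 2 * pochhammer 1 (Suc k)"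
    by (simp add: pochhammer_Suc algebra_simps)
  finally show ?case .
qed simp

text \<open>This is one term of the mixed difference
  \<open>H \<xi> \<xi> - H \<xi> 0 - H 0 \<xi> + H 0 0\<close>. The denominator belonging to
  \<open>H x y\<close> is \<open>(1 + x - y)_k\<close>, whence the three values \<open>N\<close>,
  \<open>P\<close>, \<open>M\<close> for \<open>x - y = 0\<close>, \<open>\<xi>\<close>,
  \<open>-\<xi>\<close>.\<close>

lemma padic_ideal_two_variable_expansion:
  assumes A: "A - A0 \<in> padic_ideal 1" "A0 \<in> padic_ideal 0" and B: "B - B0 \<in> padic_ideal 1" "B0 \<in> padic_ideal 0"
    and N: "padic_unit N" "padic_unit P" "padic_unit M" "P - N \<in> padic_ideal 1" "M - N \<in> padic_ideal 1"
      "P + M - 2 * N \<in> padic_ideal 2"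
  shows "A * (B / N) - A * (B0 / P) - A0 * (B / M) + A0 * (B0 / N) \<in> padic_ideal 2"
proof -
  have nz: "N \<noteq> 0" "P \<noteq> 0" "M \<noteq> 0" using N by (auto simp: padic_unit_def)
  have sq: "y * z \<in> padic_ideal 2" if "y \<in> padic_ideal 1" "z \<in> padic_ideal 1" for y z :: "'a padic"
    using padic_ideal_mult[OF that] by simp
  have B': "B \<in> padic_ideal 0"
    using padic_ideal_add[OF padic_ideal_mono[OF B(1)] B(2)] by simp
  have "N - P \<in> padic_ideal 1" "N - M \<in> padic_ideal 1"
    using padic_ideal_uminus[OF N(4)] padic_ideal_uminus[OF N(5)] by simp_all
  note N' = padic_cong_1_inverse[OF this(1) N(1,2)] padic_cong_1_inverse[OF this(2) N(1,3)]
  have 1: "B / N - B0 / P \<in> padic_ideal 1"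
    by (rule padic_cong_1_divide) (use B B' N \<open>N - P \<in> _\<close> in auto)
  have 2: "(B - B0) * (inverse N - inverse M) \<in> padic_ideal 2"
    by (intro sq B N')
  have 3: "2 * inverse N - inverse M - inverse P \<in> padic_ideal 2"
  proof -
    have "2 * inverse N - inverse M - inverse P = (N * (P + M - 2 * N) + 2 * ((M - N) * (P - N))) / (N * M * P)"
      by (rule inverse_sum_expansion[OF nz])
    also have "\<dots> \<in> padic_ideal 2"
    proof -
      have "N \<in> padic_ideal 0" "2 \<in> (padic_ideal 0 :: 'a padic set)"
        using N(1) padic_ideal_of_nat[of 2] by (simp_all add: padic_unit_def)
      from padic_ideal_mult_Zp(2)[OF this(1) N(6)] padic_ideal_mult_Zp(2)[OF this(2) sq[OF N(5,4)]]
      show ?thesis using N by (intro padic_ideal_divide_unit padic_unit_mult padic_ideal_add)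
    qed
    finally show ?thesis .
  qed
  \<comment> \<open>A regrouping of the goal: the first two products consist of two multiples of
    \<open>p\<close> each, and the last contains the second-order difference of the
    inverses.\<close>
  have "(A - A0) * (B / N - B0 / P) + A0 * ((B - B0) * (inverse N - inverse M) + B0 * (2 * inverse N - inverse M - inverse P)) \<in> padic_ideal 2"
    using sq[OF A(1) 1] padic_ideal_mult_Zp(2)[OF A(2) padic_ideal_add[OF 2 padic_ideal_mult_Zp(2)[OF B(2) 3]]]
    by (rule padic_ideal_add)
  thus ?thesis by (simp add: divide_inverse algebra_simps)
qed

subsection \<open>The truncated series\<close>

text \<open>Hypotheses (i) to (iii) in terms of the residues. Integrality of the parameters follows
  from the congruences; (iv) enters only with the terms for \<open>k > a\<close>.\<close>

locale well_poised_padic =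
  fixes \<alpha> \<beta> \<gamma> \<delta> \<epsilon> :: "'p :: prime_card padic" and a b c d e :: nat
  assumes cong: "\<alpha> + of_nat a \<in> padic_ideal 1" "\<beta> + of_nat b \<in> padic_ideal 1" "\<gamma> + of_nat c \<in> padic_ideal 1"
      "\<delta> + of_nat d \<in> padic_ideal 1" "\<epsilon> + of_nat e \<in> padic_ideal 1"
    and ge: "a \<le> b" "a \<le> c" "a \<le> d" "a \<le> e"
    and less: "b < CARD('p)" "c < CARD('p)" "d < CARD('p)" "e < CARD('p)"
    and pairs: "b + c < CARD('p) + a" "b + d < CARD('p) + a" "b + e < CARD('p) + a" "c + d < CARD('p) + a"
    and total: "2 * CARD('p) - 1 + a \<le> b + c + d + e"
    and odd: "odd CARD('p)"
begin

text \<open>Adding the bounds for \<open>b + e\<close> and \<open>c + d\<close> gives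
  \<open>b + c + d + e \<le> 2p + 2a - 2\<close>, which together with (iii) yields
  \<open>1 \<le> a\<close>.\<close>

lemma a_pos: "0 < a" "a < CARD('p)"
  using pairs total ge less by linarith+

text \<open>The factors are congruent to \<open>1 - a + z + i\<close> with \<open>i < k\<close>, and
  these integers lie between \<open>1\<close> and \<open>p - 1\<close>.\<close>

lemma unit_lower:
  assumes "\<theta> + of_nat a \<in> padic_ideal 1" "\<zeta> + of_nat z \<in> padic_ideal 1" "a \<le> z" "k + z < CARD('p) + a"
  shows "padic_unit (pochhammer (1 + \<theta> - \<zeta> :: 'p padic) k)"
proof (rule padic_unit_pochhammer)
  have "1 + \<theta> - \<zeta> - of_int (1 - int a + int z) = (\<theta> + of_nat a) - (\<zeta> + of_nat z)" by simp
  thus "1 + \<theta> - \<zeta> - of_int (1 - int a + int z) \<in> padic_ideal 1"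
    using assms padic_ideal_diff by metis
  show "\<not> int CARD('p) dvd 1 - int a + int z + int i" if "i < k" for i
    using assms that by (intro zdvd_not_zless) linarith+
qed

lemma unit_upper:
  assumes "\<zeta> + of_nat z \<in> padic_ideal 1" "k \<le> z" "z < CARD('p)"
  shows "padic_unit (pochhammer (\<zeta> :: 'p padic) k)"
proof (rule padic_unit_pochhammer)
  show "\<zeta> - of_int (- int z) \<in> padic_ideal 1"
    using assms by simp
  show "\<not> int CARD('p) dvd - int z + int i" if "i < k" for i
  proof -
    have "\<not> int CARD('p) dvd int z - int i"
      using assms that by (intro zdvd_not_zless) linarith+
    moreover have "- int z + int i = - (int z - int i)" by simp
    ultimately show ?thesis by (metis dvd_minus_iff)
  qed
qed

lemma ideal_upper:
  assumes "\<zeta> + of_nat z \<in> padic_ideal 1" "z < k"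
  shows "pochhammer (\<zeta> :: 'p padic) k \<in> padic_ideal 1"
  using assms by (intro padic_ideal_1_pochhammer[of _ "- int z" z]) simp_all

lemma Zp_of_cong:
  assumes "\<zeta> + of_nat z \<in> padic_ideal 1"
  shows "(\<zeta> :: 'p padic) \<in> padic_ideal 0"
  using padic_ideal_diff[OF padic_ideal_mono[OF assms] padic_ideal_of_nat[of z]] by simp

lemma cong_base: "- of_nat a + of_nat a \<in> (padic_ideal 1 :: 'p padic set)"
  by simp

lemma unit_one: "k < CARD('p) \<Longrightarrow> padic_unit (pochhammer (1 :: 'p padic) k)"
  by (rule padic_unit_pochhammer[of _ 1]) (simp, intro zdvd_not_zless, linarith+)

lemma two_unit: "padic_unit (2 :: 'p padic)"
proof -
  have "\<not> int CARD('p) dvd 2"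
  proof
    assume "int CARD('p) dvd 2"
    hence "int CARD('p) \<le> 2" by (rule zdvd_imp_le) simp
    hence "CARD('p) = 2" using card_gt_1[where 'p = 'p] by simp
    thus False using odd by simp
  qed
  thus ?thesis using padic_unit_cong_int[of "2 :: 'p padic" 2] by simp
qed

definition \<xi> :: "'p padic" where "\<xi> = \<alpha> + of_nat a"

text \<open>The two equations are the lower parameters \<open>1 + x - y\<close> of the well-poised
  pattern: \<open>-a\<close> over the base \<open>\<alpha>\<close>, and \<open>\<alpha>\<close> over
  the base \<open>-a\<close>.\<close>

lemma xi: "\<xi> \<in> padic_ideal 1" "1 + \<alpha> + of_nat a = 1 + \<xi>" "1 - of_nat a - \<alpha> = 1 - \<xi>"
  using cong by (simp_all add: \<xi>_def)

text \<open>
  For \<open>\<theta> = \<alpha>\<close>, multiplying by \<open>(\<alpha>)\<^sub>k / k!\<close> gives \<open>\<alpha>\<close> times the \<open>k\<close>-th term of the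
  series; the factor \<open>\<alpha>\<close> clears the denominator of \<open>(1 + \<alpha>/2)\<^sub>k / (\<alpha>/2)\<^sub>k = (\<alpha> + 2k) / \<alpha>\<close>.
\<close>

definition A :: "'p padic \<Rightarrow> nat \<Rightarrow> 'p padic" where
  "A \<theta> k = pochhammer \<theta> k * (\<theta> + 2 * of_nat k) / pochhammer 1 k
     * (pochhammer \<beta> k / pochhammer (1 + \<theta> - \<beta>) k) * (pochhammer \<gamma> k / pochhammer (1 + \<theta> - \<gamma>) k)
     * (pochhammer \<delta> k / pochhammer (1 + \<theta> - \<delta>) k) * (pochhammer \<epsilon> k / pochhammer (1 + \<theta> - \<epsilon>) k)"

lemma unit_xi:
  assumes "k \<le> a"
  shows "padic_unit (pochhammer (1 + \<xi>) k)" "padic_unit (pochhammer (1 - \<xi>) k)"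
proof -
  have "\<not> int CARD('p) dvd 1 + int i" if "i < k" for i
    using a_pos that assms by (intro zdvd_not_zless) linarith+
  thus "padic_unit (pochhammer (1 + \<xi>) k)" "padic_unit (pochhammer (1 - \<xi>) k)"
    using xi(1) padic_ideal_uminus by (intro padic_unit_pochhammer[of _ 1]; simp)+
qed

text \<open>Over the base \<open>-a\<close> the factor \<open>(-a)_k / (1)_k\<close> is itself a
  well-poised ratio, so there are six ratios in all, an even number.
  \<open>\<zeta> = \<alpha>\<close> gives \<open>H 0 \<xi>\<close> and \<open>\<zeta> = -a\<close>
  gives \<open>H 0 0\<close>.\<close>

lemma base_sums_eq_0:
  assumes "\<zeta> + of_nat a \<in> padic_ideal 1"
  shows "(\<Sum>k\<le>a. A (- of_nat a) k * (pochhammer \<zeta> k / pochhammer (1 - of_nat a - \<zeta>) k)) = 0"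
proof -
  have "(\<Sum>k\<le>a. A (- of_nat a) k * (pochhammer \<zeta> k / pochhammer (1 - of_nat a - \<zeta>) k)) =
     (\<Sum>k\<le>a. (- of_nat a + 2 * of_nat k) * (\<Prod>\<zeta>\<leftarrow>[- of_nat a, \<beta>, \<gamma>, \<delta>, \<epsilon>, \<zeta>]. pochhammer \<zeta> k / pochhammer (1 - of_nat a - \<zeta>) k))"
    by (rule sum.cong[OF refl]) (simp add: A_def ac_simps)
  also have "\<dots> = 0"
  proof (rule well_poised_sum_eq_0)
    fix z assume "z \<in> set [- of_nat a, \<beta>, \<gamma>, \<delta>, \<epsilon>, \<zeta>]"
    thus "pochhammer z a \<noteq> 0"
      using unit_upper[OF cong_base order_refl a_pos(2)] unit_upper[OF assms order_refl a_pos(2)]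
        unit_upper[OF cong(2) ge(1) less(1)] unit_upper[OF cong(3) ge(2) less(2)]
        unit_upper[OF cong(4) ge(3) less(3)] unit_upper[OF cong(5) ge(4) less(4)]
      by (auto dest!: padic_unit_nonzero)
  next
    show "(2 :: 'p padic) \<noteq> 0" using two_unit by (rule padic_unit_nonzero)
  qed simp
  finally show ?thesis .
qed

lemma whipple_sum_in_ideal:
  "(\<Sum>k\<le>a. A \<alpha> k * (pochhammer (- of_nat a) k / pochhammer (1 + \<xi>) k)) \<in> padic_ideal 2"
\<comment> \<open>Whipple's transformation requires \<open>(1 + \<alpha>)_(2a)\<close> to be
  nonzero, but \<open>\<xi>\<close> is one of its factors. If \<open>\<xi> = 0\<close>, the sum is
  \<open>H 0 0\<close>.\<close>
proof (cases "\<xi> = 0")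
  case True
  hence "\<alpha> = - of_nat a" by (simp add: \<xi>_def eq_neg_iff_add_eq_0)
  thus ?thesis using base_sums_eq_0[OF cong_base] True by simp
next
  case False
  have nz: "pochhammer (1 + \<alpha>) (2 * a) \<noteq> 0"
    unfolding pochhammer_prod prod_zero_iff[OF finite_atLeastLessThan]
  proof clarify
    fix i assume i: "i \<in> {0..<2 * a}" "1 + \<alpha> + of_nat i = 0"
    show False
    \<comment> \<open>For \<open>i + 1 = a\<close> the factor is \<open>\<xi>\<close> itself; every
      other one is congruent to a nonzero integer of absolute value at most
      \<open>a < p\<close>.\<close>
    proof (cases "Suc i = a")
      case True
      thus False using i False by (auto simp: \<xi>_def add_ac)
    next
      case ne: False
      have "1 + \<alpha> + of_nat i - of_int (1 - int a + int i) \<in> padic_ideal 1"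
        using cong(1) by simp
      moreover have "\<not> int CARD('p) dvd 1 - int a + int i"
      proof
        assume "int CARD('p) dvd 1 - int a + int i"
        hence "int CARD('p) \<le> \<bar>1 - int a + int i\<bar>" using ne dvd_imp_le_int[of "1 - int a + int i" "int CARD('p)"] by simp
        thus False using i a_pos by auto
      qed
      ultimately show False using padic_unit_cong_int i padic_unit_nonzero by blast
    qed
  qed
  have low: "padic_unit (pochhammer (1 + \<alpha> - \<beta>) k)" "padic_unit (pochhammer (1 + \<alpha> - \<gamma>) k)"
     "padic_unit (pochhammer (1 + \<alpha> - \<delta>) k)" "padic_unit (pochhammer (1 + \<alpha> - \<epsilon>) k)" "padic_unit (pochhammer (1 :: 'p padic) k)"
     if "k \<le> a" for k
    using that less ge a_pos cong by (auto intro!: unit_lower unit_one)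
  have term_in: "(-1) ^ j * pochhammer (1 + \<alpha> - \<beta> - \<epsilon>) j * pochhammer \<gamma> j * pochhammer \<delta> j * pochhammer (- of_nat a) j 
          * pochhammer (1 + \<alpha> - \<gamma> - \<delta>) (a - j) / (pochhammer 1 j * pochhammer (1 + \<alpha> - \<beta>) j * pochhammer (1 + \<alpha> - \<epsilon>) j)
     \<in> padic_ideal 1" (is "?s * ?\<theta> * ?g * ?d * ?n * ?t / ?u \<in> _") if j: "j \<le> a" for j
  proof -
    have int: "?s \<in> padic_ideal 0" "?\<theta> \<in> padic_ideal 0" "?g \<in> padic_ideal 0" "?d \<in> padic_ideal 0" "?n \<in> padic_ideal 0" "?t \<in> padic_ideal 0"
      using padic_ideal_of_int[of "(- 1) ^ j"]
      by (auto intro!: padic_ideal_pochhammer padic_ideal_diff padic_ideal_add padic_ideal_one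
         padic_ideal_uminus padic_ideal_of_nat Zp_of_cong[OF cong(1)] Zp_of_cong[OF cong(2)] Zp_of_cong[OF cong(3)]
         Zp_of_cong[OF cong(4)] Zp_of_cong[OF cong(5)])
    have "?\<theta> \<in> padic_ideal 1 \<or> ?t \<in> padic_ideal 1"
    \<comment> \<open>The factor of \<open>?\<theta>\<close> with index
      \<open>p + a - 1 - b - e\<close> is a multiple of \<open>p\<close>, as is that of
      \<open>?t\<close> with index \<open>p + a - 1 - c - d\<close>; both indices are nonnegative by
      (ii). If \<open>j\<close> is too small for the former, (iii) makes \<open>a - j\<close> large
      enough for the latter.\<close>
    proof (cases "CARD('p) + a - 1 - b - e < j")
      case True
      have "1 + \<alpha> - \<beta> - \<epsilon> - of_int (1 - int a + int b + int e) = (\<alpha> + of_nat a) - (\<beta> + of_nat b) - (\<epsilon> + of_nat e)"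
        by simp
      also have "\<dots> \<in> padic_ideal 1" by (intro padic_ideal_diff cong)
      finally have "?\<theta> \<in> padic_ideal 1"
        using True pairs by (elim padic_ideal_1_pochhammer) auto
      thus ?thesis ..
    next
      case False
      have "1 + \<alpha> - \<gamma> - \<delta> - of_int (1 - int a + int c + int d) = (\<alpha> + of_nat a) - (\<gamma> + of_nat c) - (\<delta> + of_nat d)"
        by simp
      also have "\<dots> \<in> padic_ideal 1" by (intro padic_ideal_diff cong)
      finally have "?t \<in> padic_ideal 1"
      proof (rule padic_ideal_1_pochhammer)
        show "CARD('p) + a - 1 - c - d < a - j"
          using False total pairs j by linarith
        show "int CARD('p) dvd 1 - int a + int c + int d + int (CARD('p) + a - 1 - c - d)"
          using pairs by auto
      qed
      thus ?thesis ..
    qed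
    moreover have "padic_unit ?u" using low[OF j] by (intro padic_unit_mult)
    moreover have "?s * ?\<theta> * ?g * ?d * ?n \<in> padic_ideal 0"
      using int by (intro padic_ideal_mult_Zp(1))
    moreover have "?s * ?\<theta> * ?g * ?d * ?n * ?t \<in> padic_ideal 1" if "?\<theta> \<in> padic_ideal 1"
      using padic_ideal_mult_Zp(1)[OF padic_ideal_mult_Zp(1)[OF padic_ideal_mult_Zp(1)[OF padic_ideal_mult_Zp(1)[OF
            padic_ideal_mult_Zp(2)[OF int(1) that] int(3)] int(4)] int(5)] int(6)] .
    ultimately show ?thesis
      by (metis padic_ideal_divide_unit padic_ideal_mult_Zp(2))
  qed
  have "(\<Sum>k\<le>a. A \<alpha> k * (pochhammer (- of_nat a) k / pochhammer (1 + \<xi>) k)) =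
     pochhammer \<alpha> (Suc a) / (pochhammer (1 + \<alpha> - \<gamma>) a * pochhammer (1 + \<alpha> - \<delta>) a)
      * (\<Sum>j\<le>a. (-1) ^ j * pochhammer (1 + \<alpha> - \<beta> - \<epsilon>) j * pochhammer \<gamma> j * pochhammer \<delta> j * pochhammer (- of_nat a) j 
          * pochhammer (1 + \<alpha> - \<gamma> - \<delta>) (a - j) / (pochhammer 1 j * pochhammer (1 + \<alpha> - \<beta>) j * pochhammer (1 + \<alpha> - \<epsilon>) j))"
    by (subst whipple_7F6[symmetric])
      (use nz low[OF order_refl] unit_upper[OF cong(1) order_refl a_pos(2)] in \<open>auto dest: padic_unit_nonzero simp: A_def xi(2)[symmetric] ac_simps\<close>)
  \<comment> \<open>One factor \<open>p\<close> comes from \<open>(\<alpha>)_(a+1)\<close>, which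
    reaches \<open>\<alpha> + a\<close>, the other from the sum.\<close>
  also have "\<dots> \<in> padic_ideal (1 + 1)"
    by (intro padic_ideal_mult padic_ideal_sum padic_ideal_divide_unit padic_unit_mult ideal_upper[OF cong(1)] low term_in) auto
  finally show ?thesis by simp
qed

text \<open>For \<open>k \<le> a\<close> the bound \<open>z < p\<close> implies
  \<open>k + z < p + a\<close>, so the denominator is a unit.\<close>

lemma ratio_Zp:
  assumes "\<theta> + of_nat a \<in> padic_ideal 1" "\<zeta> + of_nat z \<in> padic_ideal 1" "a \<le> z" "z < CARD('p)" "k \<le> a"
  shows "pochhammer \<zeta> k / pochhammer (1 + \<theta> - \<zeta> :: 'p padic) k \<in> padic_ideal 0"
  using assms by (intro padic_ideal_divide_unit padic_ideal_pochhammer Zp_of_cong[of \<zeta> z] unit_lower) auto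

lemma ratio_cong:
  assumes "\<theta> + of_nat a \<in> padic_ideal 1" "\<theta>' + of_nat a \<in> padic_ideal 1"
    "\<zeta> + of_nat z \<in> padic_ideal 1" "a \<le> z" "z < CARD('p)" "k \<le> a"
  shows "pochhammer \<zeta> k / pochhammer (1 + \<theta> - \<zeta> :: 'p padic) k - pochhammer \<zeta> k / pochhammer (1 + \<theta>' - \<zeta>) k \<in> padic_ideal 1"
proof (rule padic_cong_1_divide)
  have int: "1 + \<theta> - \<zeta> \<in> padic_ideal 0" "1 + \<theta>' - \<zeta> \<in> padic_ideal 0" "\<zeta> \<in> padic_ideal 0"
    using assms(1-3)[THEN Zp_of_cong] by (auto intro!: padic_ideal_diff padic_ideal_add padic_ideal_one)
  have "1 + \<theta> - \<zeta> - (1 + \<theta>' - \<zeta>) = (\<theta> + of_nat a) - (\<theta>' + of_nat a)" by simp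
  also have "\<dots> \<in> padic_ideal 1" by (intro padic_ideal_diff assms)
  finally show "pochhammer (1 + \<theta> - \<zeta>) k - pochhammer (1 + \<theta>' - \<zeta>) k \<in> padic_ideal 1"
    using int by (intro padic_cong_1_pochhammer)
  show "pochhammer \<zeta> k \<in> padic_ideal 0" by (intro padic_ideal_pochhammer int)
  show "padic_unit (pochhammer (1 + \<theta> - \<zeta>) k)" "padic_unit (pochhammer (1 + \<theta>' - \<zeta>) k)"
    using assms by (auto intro!: unit_lower)
qed simp

lemma two_mult_Zp: "2 * of_nat k \<in> (padic_ideal 0 :: 'p padic set)"
  using padic_ideal_of_nat[of "2 * k", where 'a = 'p] by simp

lemma A_Zp:
  assumes "\<theta> + of_nat a \<in> padic_ideal 1" "k \<le> a"
  shows "A \<theta> k \<in> padic_ideal 0"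
proof -
  have "\<theta> \<in> padic_ideal 0" by (rule Zp_of_cong[OF assms(1)])
  hence "pochhammer \<theta> k * (\<theta> + 2 * of_nat k) / pochhammer 1 k \<in> padic_ideal 0"
    using assms(2) a_pos two_mult_Zp[of k]
    by (intro padic_ideal_divide_unit padic_ideal_mult_Zp(1)[of "pochhammer _ _"] padic_ideal_pochhammer padic_ideal_add unit_one) auto
  thus ?thesis
    unfolding A_def
    by (intro padic_ideal_mult_Zp(1) ratio_Zp[OF assms(1) cong(2) ge(1) less(1) assms(2)]
        ratio_Zp[OF assms(1) cong(3) ge(2) less(2) assms(2)] ratio_Zp[OF assms(1) cong(4) ge(3) less(3) assms(2)]
        ratio_Zp[OF assms(1) cong(5) ge(4) less(4) assms(2)])
qed

lemma A_cong:
  assumes \<theta>: "\<theta> + of_nat a \<in> padic_ideal 1" "\<theta>' + of_nat a \<in> padic_ideal 1" "k \<le> a"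
  shows "A \<theta> k - A \<theta>' k \<in> padic_ideal 1"
proof -
  have int: "\<theta> \<in> padic_ideal 0" "\<theta>' \<in> padic_ideal 0" using \<theta>(1,2) by (auto intro: Zp_of_cong)
  have "\<theta> - \<theta>' = (\<theta> + of_nat a) - (\<theta>' + of_nat a)" by simp
  also have "\<dots> \<in> padic_ideal 1" by (intro padic_ideal_diff \<theta>)
  finally have d: "\<theta> - \<theta>' \<in> padic_ideal 1" .
  have u: "padic_unit (pochhammer (1 :: 'p padic) k)"
    using \<theta>(3) a_pos by (intro unit_one) simp
  note r = ratio_Zp[OF \<theta>(1) cong(2) ge(1) less(1) \<theta>(3)] ratio_Zp[OF \<theta>(1) cong(3) ge(2) less(2) \<theta>(3)]
    ratio_Zp[OF \<theta>(1) cong(4) ge(3) less(3) \<theta>(3)] ratio_Zp[OF \<theta>(2) cong(2) ge(1) less(1) \<theta>(3)]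
    ratio_Zp[OF \<theta>(2) cong(3) ge(2) less(2) \<theta>(3)] ratio_Zp[OF \<theta>(2) cong(4) ge(3) less(3) \<theta>(3)]
    ratio_Zp[OF \<theta>(2) cong(5) ge(4) less(4) \<theta>(3)]
    ratio_cong[OF \<theta>(1,2) cong(2) ge(1) less(1) \<theta>(3)] ratio_cong[OF \<theta>(1,2) cong(3) ge(2) less(2) \<theta>(3)]
    ratio_cong[OF \<theta>(1,2) cong(4) ge(3) less(3) \<theta>(3)] ratio_cong[OF \<theta>(1,2) cong(5) ge(4) less(4) \<theta>(3)]
  have 1: "pochhammer \<theta> k * (\<theta> + 2 * of_nat k) - pochhammer \<theta>' k * (\<theta>' + 2 * of_nat k) \<in> padic_ideal 1"
    using d int two_mult_Zp[of k]
    by (intro padic_cong_1_mult padic_cong_1_pochhammer padic_ideal_pochhammer padic_ideal_add) auto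
  have 2: "pochhammer \<theta> k * (\<theta> + 2 * of_nat k) \<in> padic_ideal 0"
    using int two_mult_Zp[of k]
    by (intro padic_ideal_mult_Zp(1)[of "pochhammer _ _"] padic_ideal_pochhammer padic_ideal_add) auto
  have "pochhammer \<theta> k * (\<theta> + 2 * of_nat k) / pochhammer 1 k - pochhammer \<theta>' k * (\<theta>' + 2 * of_nat k) / pochhammer 1 k
      \<in> padic_ideal 1" "pochhammer \<theta> k * (\<theta> + 2 * of_nat k) / pochhammer 1 k \<in> padic_ideal 0"
    by (rule padic_cong_1_divide[OF 1 _ 2 u u]) (simp, rule padic_ideal_divide_unit[OF 2 u])
  note r' = r this
  show ?thesis
    unfolding A_def
    by (intro padic_cong_1_mult padic_ideal_mult_Zp(1) r')
qed

lemma head_sum: "(\<Sum>k\<le>a. A \<alpha> k * (pochhammer \<alpha> k / pochhammer 1 k)) \<in> padic_ideal 2"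
proof -
  define A0 where "A0 = A (- of_nat a)"
  define B0 :: "nat \<Rightarrow> 'p padic" where "B0 = pochhammer (- of_nat a)"
  \<comment> \<open>\<open>?H1\<close>, \<open>?H2\<close> and \<open>?H0\<close> are the terms of
    \<open>H \<xi> 0\<close>, \<open>H 0 \<xi>\<close> and \<open>H 0 0\<close>.\<close>
  let ?H1 = "\<lambda>k. A \<alpha> k * (B0 k / pochhammer (1 + \<xi>) k)"
  let ?H2 = "\<lambda>k. A0 k * (pochhammer \<alpha> k / pochhammer (1 - \<xi>) k)"
  let ?H0 = "\<lambda>k. A0 k * (B0 k / pochhammer 1 k)"
  have "(\<Sum>k\<le>a. A \<alpha> k * (pochhammer \<alpha> k / pochhammer 1 k) - ?H1 k - ?H2 k + ?H0 k) \<in> padic_ideal 2"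
  proof (rule padic_ideal_sum)
    fix k assume "k \<in> {..a}"
    hence k: "k \<le> a" by simp
    have x0: "\<xi> \<in> padic_ideal 0" using xi(1) by (rule padic_ideal_mono) simp
    show "A \<alpha> k * (pochhammer \<alpha> k / pochhammer 1 k) - ?H1 k - ?H2 k + ?H0 k \<in> padic_ideal 2"
    proof (rule padic_ideal_two_variable_expansion)
      show "A \<alpha> k - A0 k \<in> padic_ideal 1" "A0 k \<in> padic_ideal 0"
        unfolding A0_def using cong(1) cong_base k by (auto intro: A_cong A_Zp)
      show "pochhammer \<alpha> k - B0 k \<in> padic_ideal 1" "B0 k \<in> padic_ideal 0"
        unfolding B0_def using cong(1) Zp_of_cong[OF cong(1)] Zp_of_cong[OF cong_base]
        by (auto intro!: padic_cong_1_pochhammer padic_ideal_pochhammer)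
      show "padic_unit (pochhammer (1 :: 'p padic) k)" "padic_unit (pochhammer (1 + \<xi>) k)" "padic_unit (pochhammer (1 - \<xi>) k)"
        using unit_xi[OF k] k a_pos by (auto intro: unit_one)
      show "pochhammer (1 + \<xi>) k - pochhammer 1 k \<in> padic_ideal 1" "pochhammer (1 - \<xi>) k - pochhammer 1 k \<in> padic_ideal 1"
        by (rule padic_cong_1_pochhammer;
            use xi(1) x0 in \<open>simp add: padic_ideal_uminus_iff padic_ideal_add padic_ideal_diff padic_ideal_one\<close>)+
      show "pochhammer (1 + \<xi>) k + pochhammer (1 - \<xi>) k - 2 * pochhammer 1 k \<in> padic_ideal 2"
        by (rule pochhammer_add_padic_ideal_2[OF xi(1)])
    qed
  qed
  moreover have "(\<Sum>k\<le>a. ?H1 k) \<in> padic_ideal 2"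
    unfolding B0_def by (rule whipple_sum_in_ideal)
  moreover have "(\<Sum>k\<le>a. ?H2 k) = 0"
    using base_sums_eq_0[OF cong(1)] unfolding xi A0_def .
  moreover have "(\<Sum>k\<le>a. ?H0 k) = 0"
    using base_sums_eq_0[OF cong_base] by (simp add: A0_def B0_def)
  ultimately show ?thesis
    using padic_ideal_add by (fastforce simp: sum.distrib sum_subtractf)
qed

section \<open>The terms beyond the index a\<close>

text \<open>The exponent is a lower bound for the valuation: the numerator gains \<open>p\<close>
  once \<open>k > z\<close>, and the denominator can contain \<open>p\<close> only once
  \<open>k + z \<ge> p + a\<close>. It contains it at most once, because it divides the Pochhammer
  symbol of length \<open>p - 1\<close> in (iv).\<close>

lemma ratio_ideal:
  assumes \<zeta>: "\<zeta> + of_nat z \<in> padic_ideal 1" and "a \<le> z" and k: "k < CARD('p)"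
    and nz: "pochhammer (1 + \<alpha> - \<zeta>) (CARD('p) - 1) \<notin> padic_ideal 2"
  shows "pochhammer \<zeta> k / pochhammer (1 + \<alpha> - \<zeta> :: 'p padic) k \<in> padic_ideal (of_bool (z < k) + (- of_bool (CARD('p) + a \<le> k + z)))"
  unfolding divide_inverse
proof (rule padic_ideal_mult)
  have int: "1 + \<alpha> - \<zeta> \<in> padic_ideal 0" "\<zeta> \<in> padic_ideal 0"
    using \<zeta> cong(1) by (auto intro!: padic_ideal_diff padic_ideal_add padic_ideal_one intro: Zp_of_cong)
  show "pochhammer \<zeta> k \<in> padic_ideal (of_bool (z < k))"
    using ideal_upper[OF \<zeta>] padic_ideal_pochhammer[OF int(2)] by auto
  have "pochhammer (1 + \<alpha> - \<zeta>) k \<notin> padic_ideal 2"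
  proof
    assume "pochhammer (1 + \<alpha> - \<zeta>) k \<in> padic_ideal 2"
    moreover have "pochhammer (1 + \<alpha> - \<zeta>) (CARD('p) - 1) =
        pochhammer (1 + \<alpha> - \<zeta>) k * pochhammer (1 + \<alpha> - \<zeta> + of_nat k) (CARD('p) - 1 - k)"
      using k by (intro pochhammer_product) simp
    moreover have "pochhammer (1 + \<alpha> - \<zeta> + of_nat k) (CARD('p) - 1 - k) \<in> padic_ideal 0"
      by (intro padic_ideal_pochhammer padic_ideal_add int padic_ideal_of_nat)
    ultimately show False using nz padic_ideal_mult_Zp(1) by metis
  qed
  hence "inverse (pochhammer (1 + \<alpha> - \<zeta>) k) \<in> padic_ideal (- 1)"
    by (intro inverse_padic_ideal_minus_1 padic_ideal_pochhammer int)
  moreover have "inverse (pochhammer (1 + \<alpha> - \<zeta>) k) \<in> padic_ideal 0" if "\<not> CARD('p) + a \<le> k + z"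
    using unit_lower[OF cong(1) \<zeta> \<open>a \<le> z\<close>] that by (simp add: padic_unit_def)
  ultimately show "inverse (pochhammer (1 + \<alpha> - \<zeta>) k) \<in> padic_ideal (- of_bool (CARD('p) + a \<le> k + z))"
    by auto
qed

text \<open>The two copies of \<open>(\<alpha>)_k\<close> supply \<open>p^2\<close>, so it remains
  to see that the four ratios together lose nothing.\<close>

lemma tail_term:
  assumes k: "a < k" "k < CARD('p)"
    and nz: "pochhammer (1 + \<alpha> - \<beta>) (CARD('p) - 1) \<notin> padic_ideal 2" "pochhammer (1 + \<alpha> - \<gamma>) (CARD('p) - 1) \<notin> padic_ideal 2"
      "pochhammer (1 + \<alpha> - \<delta>) (CARD('p) - 1) \<notin> padic_ideal 2" "pochhammer (1 + \<alpha> - \<epsilon>) (CARD('p) - 1) \<notin> padic_ideal 2"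
  shows "A \<alpha> k * (pochhammer \<alpha> k / pochhammer 1 k) \<in> padic_ideal 2"
proof -
  define r where "r z = of_bool (z < k) + (- of_bool (CARD('p) + a \<le> k + z) :: int)" for z
  note q = ratio_ideal[OF cong(2) ge(1) k(2) nz(1), folded r_def] ratio_ideal[OF cong(3) ge(2) k(2) nz(2), folded r_def]
    ratio_ideal[OF cong(4) ge(3) k(2) nz(3), folded r_def] ratio_ideal[OF cong(5) ge(4) k(2) nz(4), folded r_def]
  have u: "padic_unit (pochhammer (1 :: 'p padic) k)" using k by (intro unit_one)
  have \<alpha>: "pochhammer \<alpha> k \<in> padic_ideal 1" using cong(1) k(1) by (rule ideal_upper)
  have "\<alpha> + 2 * of_nat k \<in> padic_ideal 0"
    by (intro padic_ideal_add Zp_of_cong[OF cong(1)] two_mult_Zp)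
  hence "pochhammer \<alpha> k * (\<alpha> + 2 * of_nat k) / pochhammer 1 k \<in> padic_ideal 1"
    using \<alpha> u by (intro padic_ideal_divide_unit padic_ideal_mult_Zp(1))
  hence "A \<alpha> k * (pochhammer \<alpha> k / pochhammer 1 k) \<in> padic_ideal (1 + r b + r c + r d + r e + 1)"
    unfolding A_def by (intro padic_ideal_mult q padic_ideal_divide_unit[OF \<alpha> u])
  moreover have "2 \<le> 1 + r b + r c + r d + r e + 1"
  proof -
    \<comment> \<open>For example, \<open>k + b \<ge> p + a > b + c\<close> gives
      \<open>c < k\<close>. By these implications, numerators carrying \<open>p\<close> are at least
      as many as denominators that may carry it, in each of the sixteen cases.\<close>
    have "CARD('p) + a \<le> k + b \<Longrightarrow> c < k \<and> d < k \<and> e < k" "CARD('p) + a \<le> k + c \<Longrightarrow> b < k \<and> d < k"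
       "CARD('p) + a \<le> k + d \<Longrightarrow> b < k \<and> c < k" "CARD('p) + a \<le> k + e \<Longrightarrow> b < k"
      using pairs by auto
    thus ?thesis
      unfolding r_def
      by (cases "CARD('p) + a \<le> k + b"; cases "CARD('p) + a \<le> k + c"; cases "CARD('p) + a \<le> k + d";
          cases "CARD('p) + a \<le> k + e") simp_all
  qed
  ultimately show ?thesis by (rule padic_ideal_mono)
qed

end


section \<open>The very-well-poised 7F6 series modulo p^2\<close>

theorem theorem2p17:
  fixes p :: nat and \<alpha> \<beta> \<gamma> \<delta> \<epsilon> :: "'p :: prime_card padic"
  assumes "p = CARD('p)" and "odd p"
    and "\<alpha> \<in> Zp" "\<beta> \<in> Zp" "\<gamma> \<in> Zp" "\<delta> \<in> Zp" "\<epsilon> \<in> Zp"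
    and "residue (-\<alpha>) \<le> Min {residue (-\<beta>), residue (-\<gamma>), residue (-\<delta>), residue (-\<epsilon>)}"
    and "p + residue (-\<alpha>) > Max {residue (-\<beta>) + residue (-\<gamma>), residue (-\<beta>) + residue (-\<delta>),
           residue (-\<beta>) + residue (-\<epsilon>), residue (-\<gamma>) + residue (-\<delta>)}"
    and "2 * p - 1 + residue (-\<alpha>) \<le>
           residue (-\<beta>) + residue (-\<gamma>) + residue (-\<delta>) + residue (-\<epsilon>)"
    and "\<not> padic_cong 2 (pochhammer (\<alpha> - \<beta> + 1) (p - 1)) 0"
    and "\<not> padic_cong 2 (pochhammer (\<alpha> - \<gamma> + 1) (p - 1)) 0"
    and "\<not> padic_cong 2 (pochhammer (\<alpha> - \<delta> + 1) (p - 1)) 0"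
    and "\<not> padic_cong 2 (pochhammer (\<alpha> - \<epsilon> + 1) (p - 1)) 0"
    and lhs_defined: "pochhammer (1 / 2 * \<alpha>) (p - 1) \<noteq> 0"
  shows "padic_cong 2
    (hypergeom_trunc
       [\<alpha>, \<alpha>, 1 + 1 / 2 * \<alpha>, \<beta>, \<gamma>, \<delta>, \<epsilon>]
       [1, 1 / 2 * \<alpha>, \<alpha> - \<beta> + 1, \<alpha> - \<gamma> + 1, \<alpha> - \<delta> + 1, \<alpha> - \<epsilon> + 1]
       1 (p - 1)) 0"
proof -
  have cong: "x + of_nat (residue (- x)) \<in> padic_ideal 1" "residue (- x) < CARD('p)" if "x \<in> Zp" for x :: "'p padic"
  proof -
    have "- (- x - of_nat (residue (- x))) \<in> padic_ideal 1"
      by (intro padic_ideal_uminus residue_props Zp_uminus that)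
    thus "x + of_nat (residue (- x)) \<in> padic_ideal 1" by (simp add: add.commute)
  qed (intro residue_props Zp_uminus that)
  interpret well_poised_padic \<alpha> \<beta> \<gamma> \<delta> \<epsilon> "residue (- \<alpha>)" "residue (- \<beta>)" "residue (- \<gamma>)" "residue (- \<delta>)" "residue (- \<epsilon>)"
    by standard (use assms cong in auto)
  define F where "F = hypergeom_trunc
       [\<alpha>, \<alpha>, 1 + 1 / 2 * \<alpha>, \<beta>, \<gamma>, \<delta>, \<epsilon>]
       [1, 1 / 2 * \<alpha>, \<alpha> - \<beta> + 1, \<alpha> - \<gamma> + 1, \<alpha> - \<delta> + 1, \<alpha> - \<epsilon> + 1]
       1 (p - 1)"
  define h where "h = 1 / 2 * \<alpha>"
  have two: "(2 :: 'p padic) \<noteq> 0" using two_unit by (rule padic_unit_nonzero)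
  hence h: "\<alpha> = 2 * h" by (simp add: h_def)
  have comm: "\<alpha> - \<zeta> + 1 = 1 + \<alpha> - \<zeta>" for \<zeta> by simp
  have nz: "pochhammer (1 + \<alpha> - \<zeta>) (CARD('p) - 1) \<notin> padic_ideal 2"
    if "\<not> padic_cong 2 (pochhammer (\<alpha> - \<zeta> + 1) (p - 1)) 0" for \<zeta>
    using that by (simp add: padic_cong_iff_padic_ideal comm \<open>p = CARD('p)\<close>)
  \<comment> \<open>\<open>lhs_defined\<close> ensures that \<open>(\<alpha>/2)_k\<close> is
    nonzero, so that the ratio is a genuine quotient and not the default value of division by
    zero.\<close>
  have vwp: "\<alpha> * (pochhammer (1 + h) k / pochhammer h k) = \<alpha> + 2 * of_nat k" if "k \<le> p - 1" for k
  proof -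
    have "pochhammer h k \<noteq> 0"
      using pochhammer_nonzero_mono[OF lhs_defined that] by (simp add: h_def)
    moreover have "h * pochhammer (1 + h) k = pochhammer h k * (h + of_nat k)"
      by (metis pochhammer_Suc pochhammer_rec add.commute)
    ultimately have "h * (pochhammer (1 + h) k / pochhammer h k) = h + of_nat k"
      by simp
    hence "2 * (h * (pochhammer (1 + h) k / pochhammer h k)) = 2 * (h + of_nat k)"
      by (simp only:)
    thus ?thesis unfolding h by (simp only: mult.assoc distrib_left)
  qed
  have fact: "of_nat (fact k) = (pochhammer 1 k :: 'p padic)" for k
    using pochhammer_of_nat[of 1 k, where 'a = "'p padic"] by (simp add: pochhammer_fact)
  have "\<alpha> * F = (\<Sum>k\<in>{0..p - 1}. A \<alpha> k * (pochhammer \<alpha> k / pochhammer 1 k))"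
    unfolding F_def hypergeom_trunc_def sum_distrib_left
  proof (rule sum.cong[OF refl])
    fix k assume "k \<in> {0..p - 1}"
    hence "k \<le> p - 1" by simp
    note vwp = vwp[OF this, symmetric]
    show "\<alpha> * (prod_list (map (\<lambda>a. pochhammer a k) [\<alpha>, \<alpha>, 1 + 1 / 2 * \<alpha>, \<beta>, \<gamma>, \<delta>, \<epsilon>]) /
          prod_list (map (\<lambda>b. pochhammer b k) [1, 1 / 2 * \<alpha>, \<alpha> - \<beta> + 1, \<alpha> - \<gamma> + 1, \<alpha> - \<delta> + 1, \<alpha> - \<epsilon> + 1])
          * (1 ^ k / of_nat (fact k))) = A \<alpha> k * (pochhammer \<alpha> k / pochhammer 1 k)"
      unfolding A_def vwp fact comm h_def[symmetric]
      by (simp only: list.map prod_list.Cons prod_list.Nil power_one mult_1_right divide_inverse inverse_mult_distrib mult_1_left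
        flip: mult.assoc) (simp only: mult_ac)
  qed
  also have "{0..p - 1} = {..residue (- \<alpha>)} \<union> {residue (- \<alpha>)<..p - 1}"
    using a_pos \<open>p = CARD('p)\<close> by auto
  also have "(\<Sum>k\<in>\<dots>. A \<alpha> k * (pochhammer \<alpha> k / pochhammer 1 k)) =
      (\<Sum>k\<le>residue (- \<alpha>). A \<alpha> k * (pochhammer \<alpha> k / pochhammer 1 k)) +
      (\<Sum>k\<in>{residue (- \<alpha>)<..p - 1}. A \<alpha> k * (pochhammer \<alpha> k / pochhammer 1 k))"
    by (rule sum.union_disjoint) auto
  also have "\<dots> \<in> padic_ideal 2"
  proof (intro padic_ideal_add head_sum padic_ideal_sum tail_term nz assms)
    fix k assume "k \<in> {residue (- \<alpha>)<..p - 1}"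
    thus "residue (- \<alpha>) < k" "k < CARD('p)"
      using a_pos \<open>p = CARD('p)\<close> by auto
  qed
  finally have "\<alpha> * F \<in> padic_ideal 2" .
  \<comment> \<open>The case \<open>k = 1\<close> of \<open>unit_upper\<close>, available because
    \<open>0 < a < p\<close>; it allows the auxiliary factor \<open>\<alpha>\<close> to be
    removed.\<close>
  moreover have "padic_unit \<alpha>"
    using unit_upper[OF cong(1), of 1] a_pos by simp
  ultimately have "F \<in> padic_ideal 2" by (rule padic_ideal_cancel_unit)
  thus ?thesis by (simp add: padic_cong_iff_padic_ideal F_def)
qed

end
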